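(* Let $d\ge2$ and $1\le k\le d-1$. Suppose that $1\le p<\infty$, $s\in\mathbb{R}$, and $t>-d/p$. Then for every $f\in\mathcal{S}(\mathbb{R}^d)$, $$\|Pf\|_{H^{s+k/p,p}_{t+k/p}(\mathcal{G}_{k,d})}=\|f\|_{H^{s,p}_t(\mathbb{R}^d)},$$ where $P$ is the $k$-plane transform.
   Context: $G_{k,d}$ is the Grassmannian of $k$-dimensional linear subspaces of $\mathbb{R}^d$, with its rotation-invariant measure $d\alpha$ of total mass $|G_{k,d}|$, where for integers $n\ge k$ one sets $|G_{k,n}|=\frac{|\mathbb{S}^{n-1}||\mathbb{S}^{n-2}|\cdots|\mathbb{S}^{n-k}|}{2|\mathbb{S}^{k-1}||\mathbb{S}^{k-2}|\cdots|\mathbb{S}^1|}$ for $k\ge2$ and $|G_{1,n}|=|\mathbb{S}^{n-1}|/2$ (with $|\mathbb{S}^0|=2$). The affine Grassmannian is $\mathcal{G}_{k,d}=\{(\alpha,y):\alpha\in G_{k,d},\ y\in\alpha^\perp\}$, where $(\alpha,y)$ represents the affine plane $\alpha+y$. For $f\in\mathcal{S}(\mathbb{R}^d)$ the $k$-plane transform is $(Pf)(\alpha,y)=\int_{\alpha} f(x+y)\,dx$, with $dx$ Lebesgue measure on $\alpha$. The Fourier transform is unitary: $\hat f(\xi)=(2\pi)^{-d/2}\int_{\mathbb{R}^d}e^{-ix\cdot\xi}f(x)\,dx$. The fiberwise Fourier transform of $u$ on $\mathcal{G}_{k,d}$ is $\hat u(\alpha,\eta)=(2\pi)^{-(d-k)/2}\int_{\alpha^\perp}e^{-iy\cdot\eta}u(\alpha,y)\,dy$,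 $\eta\in\alpha^\perp$. Weighted Sobolev norms: for $\sigma,\tau\in\mathbb{R}$, $$\|f\|_{H^{\sigma,p}_\tau(\mathbb{R}^d)}^p=\int_{\mathbb{R}^d}\Big(|\xi|^{\tau}(1+|\xi|^2)^{\frac{\sigma-\tau}{2}}|\hat f(\xi)|\Big)^p\,d\xi,$$ $$\|u\|_{H^{\sigma,p}_\tau(\mathcal{G}_{k,d})}^p=\frac{(2\pi)^{-pk/2}}{|G_{k,d-1}|}\int_{G_{k,d}}\int_{\alpha^\perp}\Big(|\eta|^{\tau}(1+|\eta|^2)^{\frac{\sigma-\tau}{2}}|\hat u(\alpha,\eta)|\Big)^p\,d\eta\,d\alpha.$$ *)

theory Defs
  imports "HOL-Analysis.Analysis"
begin

text \<open>
  The space \<open>\<real>\<^sup>d\<close> is \<open>real^'n\<close> with \<open>d = CARD('n)\<close>. A function on the affine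
  Grassmannian \<open>{(\<alpha>, y). \<alpha> \<in> G\<^sub>k\<^sub>,\<^sub>d \<and> y \<in> \<alpha>\<^sup>\<bottom>}\<close> is a curried function
  \<open>u \<alpha> y\<close>; only its values at subspaces \<open>\<alpha>\<close> of dimension \<open>k\<close> and \<open>y \<in> \<alpha>\<^sup>\<bottom>\<close> are ever used.
\<close>

section \<open>Schwartz functions\<close>

definition partial_deriv :: "'n \<Rightarrow> (real^'n::finite \<Rightarrow> complex) \<Rightarrow> real^'n \<Rightarrow> complex" where
  "partial_deriv i f x = frechet_derivative f (at x) (axis i 1)"

definition iterated_partial :: "'n list \<Rightarrow> (real^'n::finite \<Rightarrow> complex) \<Rightarrow> real^'n \<Rightarrow> complex" where
  "iterated_partial is f = foldr partial_deriv is f"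

text \<open>Smoothness is the differentiability of all iterated partial derivatives.\<close>

definition schwartz :: "(real^'n::finite \<Rightarrow> complex) \<Rightarrow> bool" where
  "schwartz f \<longleftrightarrow>
     (\<forall>is x. iterated_partial is f differentiable (at x)) \<and>
     (\<forall>is (N::nat). bounded (range (\<lambda>x. norm x ^ N *\<^sub>R iterated_partial is f x)))"


section \<open>Lebesgue measure on a linear subspace\<close>

definition orthonormal_basis :: "(real^'n::finite) set \<Rightarrow> (real^'n) set \<Rightarrow> bool" where
  "orthonormal_basis \<alpha> B \<longleftrightarrow>
     B \<subseteq> \<alpha> \<and> span B = \<alpha> \<and> pairwise orthogonal B \<and> (\<forall>b\<in>B. norm b = 1)"

text \<open>
  Same construction as \<^const>\<open>lborel\<close>, with an orthonormal basis of \<open>\<alpha>\<close> in place of the standard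
  basis; the result does not depend on the basis. It is a Borel measure on the whole space,
  concentrated on \<open>\<alpha>\<close>.
\<close>

definition lborel_subspace :: "(real^'n::finite) set \<Rightarrow> (real^'n) measure" where
  "lborel_subspace \<alpha> =
     (let B = (SOME B. orthonormal_basis \<alpha> B)
      in distr (\<Pi>\<^sub>M b\<in>B. (lborel :: real measure)) borel (\<lambda>c. \<Sum>b\<in>B. c b *\<^sub>R b))"


section \<open>The Grassmannian and its invariant measure\<close>

definition grassmannian :: "nat \<Rightarrow> (real^'n::finite) set set" where
  "grassmannian k = {\<alpha>. subspace \<alpha> \<and> dim \<alpha> = k}"

text \<open>
  \<^term>\<open>closest_point \<alpha>\<close> is the orthogonal projection onto \<open>\<alpha>\<close>: the Grassmannian is embedded into
  the space of matrices by \<open>\<alpha> \<mapsto>\<close> (projection onto \<open>\<alpha>\<close>) and carries the induced Borel sets.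
\<close>

definition grassmannian_borel :: "nat \<Rightarrow> (real^'n::finite) set measure" where
  "grassmannian_borel k =
     vimage_algebra (grassmannian k) (\<lambda>\<alpha>. matrix (closest_point \<alpha>)) (borel :: (real^'n^'n) measure)"

text \<open>The surface measure \<open>|S\<^sup>m|\<close> of the unit sphere in \<open>\<real>\<^sup>m\<^sup>+\<^sup>1\<close>; in particular \<open>|S\<^sup>0| = 2\<close>.\<close>

definition sphere_area :: "nat \<Rightarrow> real" where
  "sphere_area m = 2 * pi powr (real (m + 1) / 2) / Gamma (real (m + 1) / 2)"

text \<open>For \<open>k = 1\<close> the product in the denominator is empty, so both cases are covered.\<close>

definition grassmannian_mass :: "nat \<Rightarrow> nat \<Rightarrow> real" where
  "grassmannian_mass k n =
     (\<Prod>j\<in>{1..k}. sphere_area (n - j)) / (2 * (\<Prod>j\<in>{1..<k}. sphere_area j))"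

definition invariant_grassmannian_measure :: "nat \<Rightarrow> (real^'n::finite) set measure \<Rightarrow> bool" where
  "invariant_grassmannian_measure k M \<longleftrightarrow>
     sets M = sets (grassmannian_borel k) \<and>
     (\<forall>T. orthogonal_transformation T \<and> det (matrix T) = 1 \<longrightarrow>
        (\<forall>A\<in>sets M. emeasure M ((`) T ` A) = emeasure M A)) \<and>
     emeasure M (space M) = ennreal (grassmannian_mass k CARD('n))"


section \<open>Transforms\<close>

definition k_plane_transform :: "(real^'n::finite \<Rightarrow> complex) \<Rightarrow> (real^'n) set \<Rightarrow> real^'n \<Rightarrow> complex" where
  "k_plane_transform f \<alpha> y = (LINT x|lborel_subspace \<alpha>. f (x + y))"

definition fourier :: "(real^'n::finite \<Rightarrow> complex) \<Rightarrow> real^'n \<Rightarrow> complex" where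
  "fourier f \<xi> =
     complex_of_real ((2 * pi) powr (- real CARD('n) / 2)) *
     (LINT x|lborel. exp (- \<i> * complex_of_real (x \<bullet> \<xi>)) * f x)"

definition fiber_fourier ::
    "nat \<Rightarrow> ((real^'n::finite) set \<Rightarrow> real^'n \<Rightarrow> complex) \<Rightarrow> (real^'n) set \<Rightarrow> real^'n \<Rightarrow> complex" where
  "fiber_fourier k u \<alpha> \<eta> =
     complex_of_real ((2 * pi) powr (- (real CARD('n) - real k) / 2)) *
     (LINT y|lborel_subspace (\<alpha>\<^sup>\<bottom>). exp (- \<i> * complex_of_real (y \<bullet> \<eta>)) * u \<alpha> y)"


section \<open>Weighted Sobolev norms\<close>

text \<open>
  Norms take values in \<open>[0, \<infinity>]\<close>. The weight is irrelevant at the origin, which is a null set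
  in \<open>\<real>\<^sup>d\<close> and in every \<open>\<alpha>\<^sup>\<bottom>\<close> with \<open>dim \<alpha> < d\<close>; hence the convention \<open>0 powr \<tau> = 0\<close> does no harm.
\<close>

definition sobolev_weight :: "real \<Rightarrow> real \<Rightarrow> real^'n::finite \<Rightarrow> real" where
  "sobolev_weight \<sigma> \<tau> \<xi> = norm \<xi> powr \<tau> * (1 + (norm \<xi>)\<^sup>2) powr ((\<sigma> - \<tau>) / 2)"

definition ennreal_root :: "real \<Rightarrow> ennreal \<Rightarrow> ennreal" where
  "ennreal_root p c = (if c = \<infinity> then \<infinity> else ennreal (enn2real c powr (1 / p)))"

definition sobolev_norm :: "real \<Rightarrow> real \<Rightarrow> real \<Rightarrow> (real^'n::finite \<Rightarrow> complex) \<Rightarrow> ennreal" where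
  "sobolev_norm \<sigma> \<tau> p f =
     ennreal_root p
       (\<integral>\<^sup>+\<xi>. ennreal ((sobolev_weight \<sigma> \<tau> \<xi> * cmod (fourier f \<xi>)) powr p) \<partial>lborel)"

text \<open>\<open>M\<close> is the measure on the Grassmannian.\<close>

definition affine_sobolev_norm ::
    "(real^'n::finite) set measure \<Rightarrow> nat \<Rightarrow> real \<Rightarrow> real \<Rightarrow> real \<Rightarrow>
     ((real^'n) set \<Rightarrow> real^'n \<Rightarrow> complex) \<Rightarrow> ennreal" where
  "affine_sobolev_norm M k \<sigma> \<tau> p u =
     ennreal_root p
       (ennreal ((2 * pi) powr (- p * real k / 2) / grassmannian_mass k (CARD('n) - 1)) *
        (\<integral>\<^sup>+\<alpha>. (\<integral>\<^sup>+\<eta>. ennreal ((sobolev_weight \<sigma> \<tau> \<eta> * cmod (fiber_fourier k u \<alpha> \<eta>)) powr p)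
                 \<partial>lborel_subspace (\<alpha>\<^sup>\<bottom>)) \<partial>M))"



section \<open>Existence of the invariant measure\<close>

text \<open>
  The span of \<open>k\<close> rows of a random invertible matrix, uniformly distributed in a ball, has an
  invariant distribution. So \<^const>\<open>invariant_grassmannian_measure\<close> is satisfiable for every
  \<open>k \<le> d\<close>.
\<close>

lemma emeasure_lborel_open_pos:
  fixes S :: "'a::euclidean_space set"
  assumes "open S" "S \<noteq> {}"
  shows "emeasure lborel S > 0"
proof (rule ccontr)
  assume "\<not> emeasure lborel S > 0"
  then have "S \<in> null_sets lborel" using assms by (auto simp: null_sets_def zero_less_iff_neq_zero)
  then have "negligible S" using negligible_iff_null_sets null_sets_completionI by blast
  then show False using open_not_negligible assms by blast
qed

lemma lborel_distr_orthogonal: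
  fixes T :: "'a::euclidean_space \<Rightarrow> 'a"
  assumes T: "orthogonal_transformation T"
  shows "distr lborel borel T = lborel"
proof -
  have lin: "linear T" using T orthogonal_transformation_linear by blast
  have meas[measurable]: "T \<in> borel_measurable borel"
    using lin by (intro borel_measurable_continuous_onI linear_continuous_on) (simp add: linear_conv_bounded_linear)
  obtain T' where T': "orthogonal_transformation T'" and inv: "\<And>x. T (T' x) = x" "\<And>x. T' (T x) = x"
    using T by (metis orthogonal_transformation_inv bij_inv_eq_iff orthogonal_transformation_bij)
  have T'n: "norm (T' x) = norm x" "norm (T x) = norm x" for x
    using T T' by (simp_all add: orthogonal_transformation)
  define \<nu> where "\<nu> = distr lborel borel T"
  have [measurable_cong, simp]: "sets \<nu> = sets borel" by (simp add: \<nu>_def)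
  define B where "B = (ball 0 1 :: 'a set)"
  have [measurable]: "B \<in> sets borel" by (simp add: B_def)
  have nuB: "emeasure \<nu> (ball 0 r) = emeasure lborel (ball (0::'a) r)" for r
  proof -
    have "T -` ball 0 r = ball 0 r" using T'n by auto
    then show ?thesis by (simp add: \<nu>_def emeasure_distr)
  qed
  interpret nu: sigma_finite_measure \<nu>
  proof
    show "\<exists>A. countable A \<and> A \<subseteq> sets \<nu> \<and> \<Union> A = space \<nu> \<and> (\<forall>a\<in>A. emeasure \<nu> a \<noteq> \<infinity>)"
    proof (intro exI[of _ "range (\<lambda>n::nat. ball (0::'a) (real n))"] conjI)
      show "\<Union> (range (\<lambda>n. ball (0::'a) (real n))) = space \<nu>"
        by (auto simp: \<nu>_def dist_norm reals_Archimedean2)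
      show "\<forall>a\<in>range (\<lambda>n. ball 0 (real n)). emeasure \<nu> a \<noteq> \<infinity>"
        using nuB emeasure_lborel_ball_finite by (metis imageE infinity_ennreal_def order_less_irrefl)
    qed auto
  qed
  have shift: "(\<integral>\<^sup>+y. h (y + x) \<partial>\<nu>) = (\<integral>\<^sup>+y. h y \<partial>\<nu>)" 
    if [measurable]: "h \<in> borel_measurable borel" for h :: "'a \<Rightarrow> ennreal" and x
  proof -
    have "(\<integral>\<^sup>+y. h (y + x) \<partial>\<nu>) = (\<integral>\<^sup>+y. h (T (y + T' x)) \<partial>lborel)"
      unfolding \<nu>_def by (subst nn_integral_distr) (auto simp: linear_add[OF lin] inv)
    also have "\<dots> = (\<integral>\<^sup>+y. h (T y) \<partial>distr lborel borel ((+) (T' x)))"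
      by (subst nn_integral_distr) (auto simp: add.commute)
    also have "\<dots> = (\<integral>\<^sup>+y. h y \<partial>\<nu>)"
      unfolding \<nu>_def lborel_distr_plus by (subst nn_integral_distr) auto
    finally show ?thesis .
  qed
  have shiftl: "(\<integral>\<^sup>+y. h (y + x) \<partial>lborel) = (\<integral>\<^sup>+y. h y \<partial>lborel)" 
    if [measurable]: "h \<in> borel_measurable borel" for h :: "'a \<Rightarrow> ennreal" and x :: 'a
  proof -
    have "(\<integral>\<^sup>+y. h (y + x) \<partial>lborel) = (\<integral>\<^sup>+y. h y \<partial>distr lborel borel ((+) x))"
      by (subst nn_integral_distr) (auto simp: add.commute)
    then show ?thesis by (simp add: lborel_distr_plus)
  qed
  interpret P: pair_sigma_finite lborel \<nu> ..
  have key: "emeasure lborel B * emeasure \<nu> A = emeasure lborel A * emeasure \<nu> B"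
    if [measurable]: "A \<in> sets borel" for A
  proof -
    have "emeasure lborel B * emeasure \<nu> A = (\<integral>\<^sup>+x. indicator B x * (\<integral>\<^sup>+y. indicator A y \<partial>\<nu>) \<partial>lborel)"
      by (simp add: nn_integral_multc)
    also have "\<dots> = (\<integral>\<^sup>+x. (\<integral>\<^sup>+y. indicator B x * indicator A (y + x) \<partial>\<nu>) \<partial>lborel)"
      using shift[of "indicator A"] by (simp add: nn_integral_cmult)
    also have "\<dots> = (\<integral>\<^sup>+y. (\<integral>\<^sup>+x. indicator B x * indicator A (y + x) \<partial>lborel) \<partial>\<nu>)"
      by (rule P.Fubini'[symmetric]) measurable
    also have "\<dots> = (\<integral>\<^sup>+y. (\<integral>\<^sup>+x. indicator B (x - y) * indicator A x \<partial>lborel) \<partial>\<nu>)"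
    proof (rule nn_integral_cong)
      fix y :: 'a
      show "(\<integral>\<^sup>+x. indicator B x * indicator A (y + x) \<partial>lborel) =
            (\<integral>\<^sup>+x. indicator B (x - y) * indicator A x \<partial>lborel)"
        using shiftl[of "\<lambda>x. indicator B (x - y) * indicator A x" y] by (simp add: add.commute)
    qed
    also have "\<dots> = (\<integral>\<^sup>+x. (\<integral>\<^sup>+y. indicator B (x - y) * indicator A x \<partial>\<nu>) \<partial>lborel)"
      by (rule P.Fubini') measurable
    also have "\<dots> = (\<integral>\<^sup>+x. indicator A x * (\<integral>\<^sup>+y. indicator B (y + (- x)) \<partial>\<nu>) \<partial>lborel)"
      by (subst nn_integral_cmult[symmetric], measurable)
         (auto intro!: nn_integral_cong simp: B_def indicator_def norm_minus_commute)
    also have "\<dots> = emeasure lborel A * emeasure \<nu> B"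
      by (subst shift) (simp_all add: nn_integral_multc)
    finally show ?thesis .
  qed
  have Bpos: "emeasure lborel B \<noteq> 0" "emeasure lborel B \<noteq> \<infinity>"
    using emeasure_lborel_ball_finite[of "0::'a" 1] emeasure_lborel_open_pos[of "ball (0::'a) 1"]
    by (auto simp: B_def)
  show ?thesis
  proof (rule measure_eqI)
    fix A assume "A \<in> sets (distr lborel borel T)"
    then have "A \<in> sets borel" by simp
    from key[OF this] nuB[of 1] have "emeasure lborel B * emeasure \<nu> A = emeasure lborel B * emeasure lborel A"
      by (simp add: B_def mult.commute)
    then show "emeasure (distr lborel borel T) A = emeasure lborel A"
      using Bpos by (simp add: ennreal_mult_cancel_left \<nu>_def)
  qed simp
qed

lemma closest_point_subspaceI:
  fixes \<alpha> :: "'a::euclidean_space set"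
  assumes "subspace \<alpha>" "y \<in> \<alpha>" "\<And>z. z \<in> \<alpha> \<Longrightarrow> (x - y) \<bullet> z = 0"
  shows "closest_point \<alpha> x = y"
proof (rule closest_point_unique[symmetric])
  show "convex \<alpha>" "closed \<alpha>" using assms(1) by (simp_all add: subspace_imp_convex closed_subspace)
  show "\<forall>z\<in>\<alpha>. dist x y \<le> dist x z"
  proof
    fix z assume "z \<in> \<alpha>"
    then have "(x - y) \<bullet> (y - z) = 0" using assms subspace_diff by blast
    then have "(norm (x - z))\<^sup>2 = (norm (x - y))\<^sup>2 + (norm (y - z))\<^sup>2"
      by (metis norm_add_Pythagorean orthogonal_def diff_add_cancel add_diff_eq)
    then show "dist x y \<le> dist x z" unfolding dist_norm
      by (metis le_add_same_cancel1 norm_ge_zero power2_le_imp_le zero_le_power2)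
  qed
qed fact

lemma closest_point_subspace:
  fixes \<alpha> :: "'a::euclidean_space set"
  assumes "subspace \<alpha>"
  shows "closest_point \<alpha> x \<in> \<alpha>" "z \<in> \<alpha> \<Longrightarrow> (x - closest_point \<alpha> x) \<bullet> z = 0"
proof -
  obtain y w where "y \<in> span \<alpha>" "\<And>w'. w' \<in> span \<alpha> \<Longrightarrow> orthogonal w w'" "x = y + w"
    using orthogonal_subspace_decomp_exists by metis
  moreover have "span \<alpha> = \<alpha>" using assms by (simp add: span_eq_iff)
  ultimately have "y \<in> \<alpha>" "\<And>z. z \<in> \<alpha> \<Longrightarrow> (x - y) \<bullet> z = 0"
    by (auto simp: orthogonal_def)
  with closest_point_subspaceI[OF assms this]
  show "closest_point \<alpha> x \<in> \<alpha>" "z \<in> \<alpha> \<Longrightarrow> (x - closest_point \<alpha> x) \<bullet> z = 0" by auto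
qed

lemma closest_point_span_insert:
  fixes a x :: "'a::euclidean_space" and S :: "'a set"
  defines "w \<equiv> a - closest_point (span S) a"
  shows "closest_point (span (insert a S)) x = closest_point (span S) x + ((x \<bullet> w) / (w \<bullet> w)) *\<^sub>R w"
proof (rule closest_point_subspaceI)
  let ?p = "closest_point (span S)"
  have p: "?p y \<in> span S" "z \<in> span S \<Longrightarrow> (y - ?p y) \<bullet> z = 0" for y z
    using closest_point_subspace[OF subspace_span] by auto
  have sub: "z \<in> span S \<Longrightarrow> z \<in> span (insert a S)" for z by (rule subsetD[OF span_mono[OF subset_insertI]])
  have "w \<in> span (insert a S)"
    unfolding w_def by (intro span_diff sub[OF p(1)]) (simp add: span_base)
  then show "?p x + ((x \<bullet> w) / (w \<bullet> w)) *\<^sub>R w \<in> span (insert a S)"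
    by (intro span_add[OF sub[OF p(1)]] span_scale)
  fix z assume "z \<in> span (insert a S)"
  then obtain c where c: "z - c *\<^sub>R a \<in> span S" by (auto simp: span_breakdown_eq)
  define z' where "z' = (z - c *\<^sub>R a) + c *\<^sub>R ?p a"
  have z': "z' \<in> span S" unfolding z'_def by (intro span_add c span_scale p)
  have z: "z = z' + c *\<^sub>R w" by (simp add: z'_def w_def algebra_simps)
  have wz: "w \<bullet> y = 0" if "y \<in> span S" for y using p that by (simp add: w_def)
  have 1: "(x - (?p x + ((x \<bullet> w) / (w \<bullet> w)) *\<^sub>R w)) \<bullet> z' = 0"
    using p(2)[OF z', of x] wz[OF z'] by (simp add: inner_diff_left inner_add_left)
  have "(x - (?p x + ((x \<bullet> w) / (w \<bullet> w)) *\<^sub>R w)) \<bullet> w = x \<bullet> w - ((x \<bullet> w) / (w \<bullet> w)) * (w \<bullet> w)"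
    using wz[OF p(1), of x] inner_commute[of w "?p x"]
    by (simp add: inner_diff_left inner_add_left del: times_divide_eq_left times_divide_eq_right)
  also have "\<dots> = 0" by (cases "w = 0") auto
  finally show "(x - (?p x + ((x \<bullet> w) / (w \<bullet> w)) *\<^sub>R w)) \<bullet> z = 0"
    using 1 by (simp add: z inner_add_right)
qed (rule subspace_span)

lemma measurable_closest_point_span:
  assumes "finite I" and "g \<in> borel_measurable borel"
  shows "(\<lambda>v::real^'n::finite^'n. closest_point (span ((\<lambda>i. v $ i) ` I)) (g v)) \<in> borel_measurable borel"
  using assms
proof (induction I arbitrary: g)
  case empty
  have "closest_point {0::real^'n} y = 0" for y by (intro closest_point_subspaceI) auto
  then show ?case by simp
next
  case (insert i I)
  note [measurable] = insert.prems
  have [measurable]: "(\<lambda>v::real^'n^'n. v $ i) \<in> borel_measurable borel"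
    by (intro borel_measurable_continuous_onI continuous_intros)
  note [measurable] = insert.IH[OF insert.prems] insert.IH[of "\<lambda>v. v $ i"]
  show ?case
    unfolding image_insert closest_point_span_insert by measurable
qed

lemma linear_closest_point_subspace:
  fixes \<alpha> :: "'a::euclidean_space set"
  assumes "subspace \<alpha>"
  shows "linear (closest_point \<alpha>)"
proof (rule linearI; rule closest_point_subspaceI[OF assms])
  note cp = closest_point_subspace[OF assms]
  fix x y z and r :: real
  show "closest_point \<alpha> x + closest_point \<alpha> y \<in> \<alpha>" "r *\<^sub>R closest_point \<alpha> x \<in> \<alpha>"
    using cp(1) by (simp_all add: subspace_add[OF assms] subspace_scale[OF assms])
  assume "z \<in> \<alpha>"
  from cp(2)[OF this, of x] cp(2)[OF this, of y]
  show "(x + y - (closest_point \<alpha> x + closest_point \<alpha> y)) \<bullet> z = 0"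
    and "(r *\<^sub>R x - r *\<^sub>R closest_point \<alpha> x) \<bullet> z = 0"
    by (simp_all add: inner_diff_left inner_add_left)
qed

lemma image_grassmannian:
  assumes "orthogonal_transformation T" "\<alpha> \<in> grassmannian k"
  shows "T ` \<alpha> \<in> grassmannian k"
proof -
  have "linear T" using assms(1) by (rule orthogonal_transformation_linear)
  then have "dim (T ` \<alpha>) = dim \<alpha>"
    using inj_on_subset[OF orthogonal_transformation_inj[OF assms(1)]] by (intro dim_image_eq) auto
  then show ?thesis using assms(2) \<open>linear T\<close> by (simp add: grassmannian_def linear_subspace_image)
qed

lemma measurable_image_grassmannian:
  assumes T: "orthogonal_transformation (T :: real^'n::finite \<Rightarrow> real^'n)"
  shows "(`) T \<in> grassmannian_borel k \<rightarrow>\<^sub>M grassmannian_borel k"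
  unfolding grassmannian_borel_def[of k]
proof (rule measurable_vimage_algebra2)
  let ?G = "vimage_algebra (grassmannian k) (\<lambda>\<alpha>::(real^'n) set. matrix (closest_point \<alpha>)) borel"
  show "(`) T \<in> space ?G \<rightarrow> grassmannian k"
    using image_grassmannian[OF T] by auto
  define T' where "T' = inv T"
  have T': "orthogonal_transformation T'" unfolding T'_def using T by (rule orthogonal_transformation_inv)
  have bij: "T (T' x) = x" "T' (T x) = x" for x
    using orthogonal_transformation_bij[OF T] by (simp_all add: T'_def bij_is_surj surj_f_inv_f bij_is_inj)
  have lin: "linear T" "linear T'" using T T' orthogonal_transformation_linear by auto
  have eq: "matrix (closest_point (T ` \<alpha>)) = matrix T ** matrix (closest_point \<alpha>) ** matrix T'"
    if "\<alpha> \<in> grassmannian k" for \<alpha>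
  proof -
    have sub: "subspace \<alpha>" using that by (simp add: grassmannian_def)
    have "closest_point (T ` \<alpha>) x = T (closest_point \<alpha> (T' x))" for x
    proof (rule closest_point_subspaceI)
      show "subspace (T ` \<alpha>)" using sub lin by (simp add: linear_subspace_image)
      show "T (closest_point \<alpha> (T' x)) \<in> T ` \<alpha>" using closest_point_subspace[OF sub] by blast
      fix z assume "z \<in> T ` \<alpha>"
      then obtain a where a: "a \<in> \<alpha>" "z = T a" by blast
      have "(x - T (closest_point \<alpha> (T' x))) \<bullet> z = T (T' x - closest_point \<alpha> (T' x)) \<bullet> T a"
        by (simp add: linear_diff[OF lin(1)] bij a)
      also have "\<dots> = (T' x - closest_point \<alpha> (T' x)) \<bullet> a"
        using T by (simp add: orthogonal_transformation_def)
      finally show "(x - T (closest_point \<alpha> (T' x))) \<bullet> z = 0"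
        using closest_point_subspace(2)[OF sub a(1)] by simp
    qed
    then have "closest_point (T ` \<alpha>) = T \<circ> (closest_point \<alpha> \<circ> T')" by auto
    then show ?thesis
      using lin linear_closest_point_subspace[OF sub]
      by (simp add: matrix_compose linear_compose matrix_mul_assoc)
  qed
  have "continuous_on UNIV (\<lambda>X. matrix T ** X ** matrix T')"
    unfolding matrix_matrix_mult_def by (intro continuous_intros)
  then have "(\<lambda>X. matrix T ** X ** matrix T') \<in> borel_measurable borel"
    by (rule borel_measurable_continuous_onI)
  then have "(\<lambda>\<alpha>. matrix T ** matrix (closest_point \<alpha>) ** matrix T') \<in> ?G \<rightarrow>\<^sub>M borel"
    by (rule measurable_compose[rotated]) (auto intro: measurable_vimage_algebra1)
  then show "(\<lambda>\<alpha>. matrix (closest_point (T ` \<alpha>))) \<in> ?G \<rightarrow>\<^sub>M borel"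
    by (subst measurable_cong[of ?G]) (auto simp: eq)
qed

lemma ex_invariant_grassmannian_measure:
  assumes "k \<le> CARD('n::finite)"
  shows "\<exists>M :: (real^'n) set measure. invariant_grassmannian_measure k M"
proof -
  obtain I :: "'n set" where I: "card I = k" using assms by (metis obtain_subset_with_card_n)
  define \<Omega> where "\<Omega> = ball (0::real^'n^'n) (norm (mat 1 :: real^'n^'n) + 1) \<inter> {v. det v \<noteq> 0}"
  define S where "S v = span ((\<lambda>i. v $ i) ` I)" for v :: "real^'n^'n"
  have cdet: "continuous_on UNIV (\<lambda>v::real^'n^'n. det v)"
    unfolding det_def by (intro continuous_intros)
  have "open {v::real^'n^'n. det v \<noteq> 0}"
    by (intro open_Collect_neq cdet continuous_on_const)
  then have op: "open \<Omega>" by (auto simp: \<Omega>_def)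
  have "mat 1 \<in> \<Omega>" by (simp add: \<Omega>_def)
  have pos: "emeasure lborel \<Omega> > 0"
    using \<open>mat 1 \<in> \<Omega>\<close> by (intro emeasure_lborel_open_pos[OF op]) auto
  have fin: "emeasure lborel \<Omega> < \<infinity>"
    by (rule order_le_less_trans[OF emeasure_mono emeasure_lborel_ball_finite]) (auto simp: \<Omega>_def)
  have [measurable]: "\<Omega> \<in> sets borel" using op by simp
  have SG: "S v \<in> grassmannian k" if "v \<in> \<Omega>" for v
  proof -
    have "det v \<noteq> 0" using that by (simp add: \<Omega>_def)
    have inj: "inj (\<lambda>i. v $ i)"
      by (rule injI) (use det_identical_rows[of _ _ v] \<open>det v \<noteq> 0\<close> in \<open>auto simp: row_def vec_nth_inverse\<close>)
    have "inj ((*v) (transpose v))"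
      using \<open>det v \<noteq> 0\<close> det_nz_iff_inj[OF matrix_vector_mul_linear[of "transpose v"]]
      unfolding matrix_of_matrix_vector_mul by (simp only: det_transpose simp_thms)
    then have "independent ((*v) (transpose v) ` ((\<lambda>i. axis i 1) ` I))"
      by (intro linear_independent_injective_image matrix_vector_mul_linear independent_mono[OF independent_Basis])
         (auto simp: Basis_vec_def intro: inj_on_subset)
    moreover have "transpose v *v axis i 1 = v $ i" for i
      by (simp add: matrix_vector_mult_basis column_def transpose_def vec_eq_iff del: transpose_matrix_vector)
    ultimately have "independent ((\<lambda>i. v $ i) ` I)"
      unfolding image_image by simp
    then show ?thesis
      by (simp add: grassmannian_def S_def dim_eq_card_independent card_image[OF inj_on_subset[OF inj]] I)
  qed
  define N where "N = restrict_space lborel \<Omega>"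
  have spN: "space N = \<Omega>" by (simp add: N_def space_restrict_space)
  have Smeas[measurable]: "S \<in> N \<rightarrow>\<^sub>M grassmannian_borel k"
    unfolding grassmannian_borel_def
  proof (rule measurable_vimage_algebra2)
    show "S \<in> space N \<rightarrow> grassmannian k" using SG by (auto simp: spN)
    have "(\<lambda>v. matrix (closest_point (S v))) \<in> borel_measurable borel"
      unfolding matrix_def
    proof (subst borel_measurable_euclidean_space, intro ballI)
      fix b :: "real^'n^'n" assume "b \<in> Basis"
      then obtain i j where b: "b = axis i (axis j 1)" by (auto simp: Basis_vec_def)
      have "(\<lambda>v. closest_point (S v) (axis j 1)) \<in> borel_measurable borel"
        unfolding S_def by (intro measurable_closest_point_span) auto
      then have "(\<lambda>v. closest_point (S v) (axis j 1) \<bullet> axis i 1) \<in> borel_measurable borel"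
        by measurable
      then show "(\<lambda>v. (\<chi> i j. closest_point (S v) (axis j 1) $ i) \<bullet> b) \<in> borel_measurable borel"
        by (simp add: b inner_axis)
    qed
    then show "(\<lambda>v. matrix (closest_point (S v))) \<in> N \<rightarrow>\<^sub>M borel"
      by (auto simp: N_def intro: measurable_restrict_space1)
  qed
  define c where "c = ennreal (grassmannian_mass k CARD('n)) / emeasure lborel \<Omega>"
  define M where "M = scale_measure c (distr N (grassmannian_borel k) S)"
  have sM: "sets M = sets (grassmannian_borel k)" by (simp add: M_def)
  have em: "emeasure M A = c * emeasure lborel (S -` A \<inter> \<Omega>)" if "A \<in> sets M" for A
  proof -
    have A: "A \<in> sets (grassmannian_borel k)" using that sM by simp
    have "emeasure M A = c * emeasure N (S -` A \<inter> \<Omega>)"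
      using A by (simp add: M_def emeasure_distr[OF Smeas] spN)
    also have "emeasure N (S -` A \<inter> \<Omega>) = emeasure lborel (S -` A \<inter> \<Omega>)"
      unfolding N_def by (rule emeasure_restrict_space) auto
    finally show ?thesis .
  qed
  show ?thesis
  proof (intro exI[of _ M], unfold invariant_grassmannian_measure_def, intro conjI allI impI ballI)
    show "sets M = sets (grassmannian_borel k)" by fact
    have "space M = grassmannian k" by (simp add: M_def space_scale_measure grassmannian_borel_def)
    then have "S -` space M \<inter> \<Omega> = \<Omega>" using SG by auto
    then have "emeasure M (space M) = c * emeasure lborel \<Omega>" by (simp add: em)
    then show "emeasure M (space M) = ennreal (grassmannian_mass k CARD('n))"
      unfolding c_def using pos fin 
      by (simp add: ennreal_divide_times ennreal_mult_divide_eq ennreal_times_divide)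
  next
    fix T :: "real^'n \<Rightarrow> real^'n" and A
    assume T': "orthogonal_transformation T \<and> det (matrix T) = 1" and A: "A \<in> sets M"
    then have T: "orthogonal_transformation T" by simp
    then have lin: "linear T" and bij: "bij T" and nT: "\<And>x. norm (T x) = norm x"
      by (auto simp: orthogonal_transformation_linear orthogonal_transformation_bij orthogonal_transformation)
    have dM: "det (matrix T) = 1" using T' by simp
    define L where "L v = (\<chi> i. T (v $ i))" for v :: "real^'n^'n"
    have linL: "linear L" unfolding L_def
      by (rule linearI) (auto simp: vec_eq_iff linear_add[OF lin] linear_scale[OF lin])
    have nL: "norm (L v) = norm v" for v 
      by (simp add: norm_vec_def[of "L v"] norm_vec_def[of v]) (simp add: L_def nT)
    have OL: "orthogonal_transformation L" using linL nL by (simp add: orthogonal_transformation)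
    have Lm: "L v = v ** transpose (matrix T)" for v
    proof -
      have "T (v $ i) $ j = (\<Sum>k\<in>UNIV. v $ i $ k * (matrix T) $ j $ k)" for i j
        using arg_cong[OF fun_cong[OF matrix_vector_mul(2)[OF lin], of "v $ i"], of "\<lambda>y. y $ j"]
        by (simp only: matrix_vector_mult_def vec_lambda_beta mult.commute)
      then show ?thesis by (simp add: L_def matrix_matrix_mult_def transpose_def vec_eq_iff)
    qed
    have detL: "det (L v) = det v" for v by (simp add: Lm det_mul dM)
    have L\<Omega>: "L v \<in> \<Omega> \<longleftrightarrow> v \<in> \<Omega>" for v by (simp add: \<Omega>_def nL detL)
    have SL: "S (L v) = T ` S v" for v
      by (simp add: S_def L_def linear_span_image[OF lin, symmetric] image_image)
    have injT: "inj ((`) T)" using bij by (metis bij_is_inj inj_image_eq_iff injI)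
    define T'' where "T'' = inv T"
    have T'': "orthogonal_transformation T''" unfolding T''_def using T by (rule orthogonal_transformation_inv)
    have vim: "L -` (S -` ((`) T ` A) \<inter> \<Omega>) = S -` A \<inter> \<Omega>"
      by (simp only: set_eq_iff vimage_eq Int_iff L\<Omega> SL inj_image_mem_iff[OF injT]) simp
    have TA: "(`) T ` A \<in> sets M"
    proof -
      have bij'': "T (T'' x) = x" "T'' (T x) = x" for x
        using bij by (simp_all add: T''_def bij_is_surj surj_f_inv_f bij_is_inj)
      have img: "(`) T ` A = (`) T'' -` A \<inter> space (grassmannian_borel k)"
      proof -
        have "A \<subseteq> grassmannian k" using sets.sets_into_space[OF A] by (simp add: M_def space_scale_measure grassmannian_borel_def)
        then have "T ` \<alpha> \<in> grassmannian k" if "\<alpha> \<in> A" for \<alpha>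
          using that image_grassmannian[OF T] by blast
        moreover have "T'' ` T ` \<alpha> = \<alpha>" "T ` T'' ` \<alpha> = \<alpha>" for \<alpha> by (simp_all add: image_image bij'')
        ultimately have "\<beta> \<in> (`) T ` A \<longleftrightarrow> \<beta> \<in> grassmannian k \<and> T'' ` \<beta> \<in> A" for \<beta>
          by (metis image_eqI imageE)
        then show ?thesis by (auto simp only: grassmannian_borel_def space_vimage_algebra vimage_eq Int_iff)
      qed
      have "(`) T'' \<in> grassmannian_borel k \<rightarrow>\<^sub>M grassmannian_borel k"
        by (rule measurable_image_grassmannian[OF T''])
      from measurable_sets[OF this] show ?thesis using A unfolding img sM by blast
    qed
    have "L \<in> borel_measurable borel"
      using linL by (intro borel_measurable_continuous_onI linear_continuous_on) (simp add: linear_conv_bounded_linear)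
    moreover have "S -` ((`) T ` A) \<inter> \<Omega> \<in> sets borel"
      using measurable_sets[OF Smeas, of "(`) T ` A"] TA sM by (auto simp: spN N_def sets_restrict_space_iff)
    ultimately have "emeasure lborel (S -` ((`) T ` A) \<inter> \<Omega>) = emeasure lborel (S -` A \<inter> \<Omega>)"
      using emeasure_distr[of L lborel borel "S -` ((`) T ` A) \<inter> \<Omega>"]
      by (simp only: lborel_distr_orthogonal[OF OL] vim space_lborel space_borel Int_UNIV_right measurable_lborel2 simp_thms)
    then show "emeasure M ((`) T ` A) = emeasure M A" by (simp add: em A TA)
  qed
qed
end

theory Submission
  imports Defs
begin

text \<open>
  By Fubini, the fiberwise Fourier transform of \<open>Pf\<close> at \<open>(\<alpha>, \<eta>)\<close> is \<open>(2\<pi>)\<^sup>k\<^sup>/\<^sup>2\<close> times the Fourier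
  transform of \<open>f\<close> at \<open>\<eta> \<in> \<alpha>\<^sup>\<bottom>\<close>. Since the weight shifted by \<open>k/p\<close> contributes \<open>|\<eta>|\<^sup>k\<close> after taking
  \<open>p\<close>-th powers, the claim reduces to
  \<open>\<integral>\<integral> |\<eta>|\<^sup>k g(\<eta>) d\<eta> d\<alpha> = |G\<^sub>k\<^sub>,\<^sub>d\<^sub>-\<^sub>1| \<integral> g(\<xi>) d\<xi>\<close> for nonnegative Borel \<open>g\<close>. Both sides are
  rotation invariant in \<open>g\<close>, so \<open>g\<close> may be averaged over a random rotation, namely the
  Gram--Schmidt orthonormalization of a matrix uniformly distributed in a ball. The average is radial,
  and for radial functions both sides are multiples of \<open>\<integral> r\<^sup>d\<^sup>-\<^sup>1 g(r) dr\<close>, with constants that agree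
  because \<open>|G\<^sub>k\<^sub>,\<^sub>d| |S\<^sup>d\<^sup>-\<^sup>k\<^sup>-\<^sup>1| = |G\<^sub>k\<^sub>,\<^sub>d\<^sub>-\<^sub>1| |S\<^sup>d\<^sup>-\<^sup>1|\<close>.
\<close>

section \<open>Lebesgue measure of a subspace\<close>

text \<open>The formula of \<open>lborel_subspace\<close> with the basis as an argument. Bases can
  then be united or replaced explicitly, which the choice by \<open>SOME\<close> does not
  allow.\<close>

definition onb_measure :: "'a::euclidean_space set \<Rightarrow> 'a measure" where
  "onb_measure B = distr (\<Pi>\<^sub>M b\<in>B. (lborel :: real measure)) borel (\<lambda>c. \<Sum>b\<in>B. c b *\<^sub>R b)"

definition orthonormal :: "'a::euclidean_space set \<Rightarrow> bool" where
  "orthonormal B \<longleftrightarrow> finite B \<and> pairwise orthogonal B \<and> (\<forall>b\<in>B. norm b = 1)"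

lemma orthonormal_inner:
  "orthonormal B \<Longrightarrow> b \<in> B \<Longrightarrow> c \<in> B \<Longrightarrow> b \<bullet> c = (if b = c then 1 else 0)"
  by (auto simp: orthonormal_def pairwise_def orthogonal_def norm_eq_1)

lemma sets_onb_measure [measurable_cong, simp]: "sets (onb_measure B) = sets borel"
  by (simp add: onb_measure_def)

lemma space_onb_measure [simp]: "space (onb_measure B) = UNIV"
  by (simp add: onb_measure_def)

lemma measurable_onb_sum [measurable]:
  "(\<lambda>c. \<Sum>b\<in>B. c b *\<^sub>R (b :: 'a::euclidean_space)) \<in> borel_measurable (\<Pi>\<^sub>M b\<in>B. (lborel :: real measure))"
  by (intro borel_measurable_sum borel_measurable_scaleR) auto

text \<open>A bijection of the standard basis onto \<open>B\<close> extends to an orthogonal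
  transformation \<open>T\<close>. Hence the measure is the image of \<open>lborel\<close> under
  \<open>T\<close>, and \<open>lborel\<close> is invariant under \<open>T\<close>.\<close>

lemma onb_measure_UNIV:
  fixes B :: "'a::euclidean_space set"
  assumes B: "orthonormal B" and card: "card B = DIM('a)"
  shows "onb_measure B = lborel"
proof -
  interpret product_sigma_finite "\<lambda>_::'a. (lborel :: real measure)" ..
  have fin: "finite B" using B by (simp add: orthonormal_def)
  obtain \<phi> where \<phi>: "bij_betw \<phi> (Basis :: 'a set) B"
    using finite_same_card_bij[OF finite_Basis fin] card by auto
  define T where "T x = (\<Sum>b\<in>Basis. (x \<bullet> b) *\<^sub>R \<phi> b)" for x
  have lin: "linear T"
    by (rule linearI) (simp_all add: T_def inner_add_left scaleR_add_left sum.distrib scaleR_sum_right)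
  have \<phi>B: "b \<in> Basis \<Longrightarrow> \<phi> b \<in> B" for b using \<phi> by (auto simp: bij_betw_def)
  have \<phi>inj: "b \<in> Basis \<Longrightarrow> c \<in> Basis \<Longrightarrow> \<phi> b = \<phi> c \<longleftrightarrow> b = c" for b c
    using \<phi> by (auto simp: bij_betw_def inj_on_def)
  have "T x \<bullet> T y = x \<bullet> y" for x y
  proof -
    have "T x \<bullet> T y = (\<Sum>b\<in>Basis. \<Sum>c\<in>Basis. (x \<bullet> b) * (y \<bullet> c) * (\<phi> b \<bullet> \<phi> c))"
      by (simp add: T_def inner_sum_left inner_sum_right sum_distrib_left mult_ac) (rule sum.swap)
    also have "\<dots> = (\<Sum>b\<in>Basis. \<Sum>c\<in>Basis. if b = c then (x \<bullet> b) * (y \<bullet> c) else 0)"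
      by (intro sum.cong refl) (simp add: orthonormal_inner[OF B \<phi>B \<phi>B] \<phi>inj)
    also have "\<dots> = x \<bullet> y" by (subst euclidean_inner) simp
    finally show ?thesis .
  qed
  then have T: "orthogonal_transformation T" using lin by (simp add: orthogonal_transformation_def)
  define \<psi> where "\<psi> = inv_into Basis \<phi>"
  have \<psi>: "b \<in> B \<Longrightarrow> \<psi> b \<in> Basis" "b \<in> B \<Longrightarrow> \<phi> (\<psi> b) = b" for b
    using \<phi> by (auto simp: bij_betw_def \<psi>_def inv_into_into f_inv_into_f)
  have \<psi>\<phi>: "b \<in> Basis \<Longrightarrow> \<psi> (\<phi> b) = b" for b
    using \<phi> by (auto simp: bij_betw_def \<psi>_def)
  \<comment> \<open>Coordinates indexed by \<open>Basis\<close> become coordinates indexed by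
    \<open>B\<close>; the restriction to \<open>B\<close> keeps them extensional, as the space of
    \<open>PiM\<close> demands.\<close>
  define R where "R c = (\<lambda>b\<in>B. c (\<psi> b))" for c :: "'a \<Rightarrow> real"
  have Rm[measurable]: "R \<in> (\<Pi>\<^sub>M b\<in>Basis. lborel) \<rightarrow>\<^sub>M (\<Pi>\<^sub>M b\<in>B. lborel)"
    unfolding R_def by (intro measurable_restrict measurable_component_singleton \<psi>)
  \<comment> \<open>A finite product measure is determined by its values on boxes, and a box over
    \<open>B\<close> pulls back under \<open>R\<close> to the relabelled box over
    \<open>Basis\<close>.\<close>
  have distrR: "distr (\<Pi>\<^sub>M b\<in>Basis. lborel) (\<Pi>\<^sub>M b\<in>B. lborel) R = (\<Pi>\<^sub>M b\<in>B. (lborel :: real measure))"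
  proof (rule PiM_eqI[OF fin])
    fix A :: "'a \<Rightarrow> real set" assume A: "\<And>i. i \<in> B \<Longrightarrow> A i \<in> sets lborel"
    have "R -` (Pi\<^sub>E B A) \<inter> space (\<Pi>\<^sub>M b\<in>Basis. lborel) = (\<Pi>\<^sub>E b\<in>Basis. A (\<phi> b))"
    proof (intro set_eqI)
      fix c :: "'a \<Rightarrow> real"
      have "(\<forall>b\<in>B. c (\<psi> b) \<in> A b) \<longleftrightarrow> (\<forall>b\<in>Basis. c (\<psi> (\<phi> b)) \<in> A (\<phi> b))"
        using \<phi> by (auto simp: bij_betw_def)
      then show "c \<in> R -` (Pi\<^sub>E B A) \<inter> space (\<Pi>\<^sub>M b\<in>Basis. lborel) \<longleftrightarrow> c \<in> (\<Pi>\<^sub>E b\<in>Basis. A (\<phi> b))"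
        unfolding vimage_eq Int_iff space_PiM R_def PiE_iff by (simp add: \<psi>\<phi>)
    qed
    then have "emeasure (distr (\<Pi>\<^sub>M b\<in>Basis. lborel) (\<Pi>\<^sub>M b\<in>B. lborel) R) (Pi\<^sub>E B A)
        = (\<Prod>b\<in>Basis. emeasure lborel (A (\<phi> b)))"
      using A fin \<phi>B by (subst emeasure_distr) (auto intro!: sets_PiM_I_finite simp: emeasure_PiM)
    also have "\<dots> = (\<Prod>b\<in>B. emeasure lborel (A b))"
      by (rule prod.reindex_bij_betw[OF \<phi>])
    finally show "emeasure (distr (\<Pi>\<^sub>M b\<in>Basis. lborel) (\<Pi>\<^sub>M b\<in>B. lborel) R) (Pi\<^sub>E B A) = \<dots>" .
  qed simp
  have [measurable]: "T \<in> borel_measurable borel"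
    using lin by (intro borel_measurable_continuous_onI linear_continuous_on) (simp add: linear_conv_bounded_linear)
  have "onb_measure B = distr (distr (\<Pi>\<^sub>M b\<in>Basis. lborel) (\<Pi>\<^sub>M b\<in>B. lborel) R) borel (\<lambda>c. \<Sum>b\<in>B. c b *\<^sub>R b)"
    unfolding onb_measure_def distrR ..
  also have "\<dots> = distr (\<Pi>\<^sub>M b\<in>Basis. lborel) borel ((\<lambda>c. \<Sum>b\<in>B. c b *\<^sub>R b) \<circ> R)"
    by (rule distr_distr) measurable
  also have "\<dots> = distr (\<Pi>\<^sub>M b\<in>Basis. lborel) borel (T \<circ> (\<lambda>c. \<Sum>b\<in>Basis. c b *\<^sub>R b))"
  proof (rule distr_cong)
    fix c :: "'a \<Rightarrow> real"
    have "(\<Sum>b\<in>B. R c b *\<^sub>R b) = (\<Sum>b\<in>Basis. R c (\<phi> b) *\<^sub>R \<phi> b)"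
      by (rule sum.reindex_bij_betw[OF \<phi>, symmetric])
    also have "\<dots> = T (\<Sum>b\<in>Basis. c b *\<^sub>R b)"
      unfolding T_def by (intro sum.cong refl) (simp add: R_def \<phi>B \<psi>\<phi>)
    finally show "((\<lambda>c. \<Sum>b\<in>B. c b *\<^sub>R b) \<circ> R) c = (T \<circ> (\<lambda>c. \<Sum>b\<in>Basis. c b *\<^sub>R b)) c" by simp
  qed auto
  also have "\<dots> = distr lborel borel T"
    by (subst lborel_eq, rule distr_distr[symmetric]) measurable
  also have "\<dots> = lborel" by (rule lborel_distr_orthogonal[OF T])
  finally show ?thesis .
qed

lemma norm_onb_sum:
  assumes "orthonormal B"
  shows "norm (\<Sum>b\<in>B. c b *\<^sub>R b) = sqrt (\<Sum>b\<in>B. (c b)\<^sup>2)"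
proof -
  have "(\<Sum>b\<in>B. c b *\<^sub>R b) \<bullet> (\<Sum>b\<in>B. c b *\<^sub>R b) = (\<Sum>b\<in>B. \<Sum>b'\<in>B. if b = b' then (c b)\<^sup>2 else 0)"
    unfolding inner_sum_left inner_sum_right
    by (intro sum.cong refl) (simp add: orthonormal_inner[OF assms] power2_eq_square)
  also have "\<dots> = (\<Sum>b\<in>B. (c b)\<^sup>2)" using assms by (simp add: orthonormal_def)
  finally show ?thesis by (simp add: norm_eq_sqrt_inner)
qed

text \<open>By orthonormality the norm is the Euclidean norm of the coordinate vector, so the
  preimage of the ball is the standard ball in coordinate space.\<close>

lemma emeasure_onb_measure_cball:
  fixes B :: "'a::euclidean_space set"
  assumes B: "orthonormal B" and r: "r > 0"
  shows "emeasure (onb_measure B) (cball 0 r) = ennreal (unit_ball_vol (real (card B)) * r ^ card B)"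
proof -
  have "emeasure (onb_measure B) (cball 0 r) =
      emeasure (\<Pi>\<^sub>M b\<in>B. lborel) ({c. sqrt (\<Sum>b\<in>B. (c b)\<^sup>2) \<le> r} \<inter> space (\<Pi>\<^sub>M b\<in>B. lborel))"
    unfolding onb_measure_def by (subst emeasure_distr) (auto simp: norm_onb_sum[OF B] vimage_def)
  also have "\<dots> = ennreal (unit_ball_vol (real (card B)) * r ^ card B)"
    using B r by (intro emeasure_cball_aux) (auto simp: orthonormal_def)
  finally show ?thesis .
qed

lemma sigma_finite_onb_measure:
  fixes B :: "'a::euclidean_space set"
  assumes B: "orthonormal B"
  shows "sigma_finite_measure (onb_measure B)"
proof
  show "\<exists>A. countable A \<and> A \<subseteq> sets (onb_measure B) \<and> \<Union> A = space (onb_measure B) \<and>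
      (\<forall>a\<in>A. emeasure (onb_measure B) a \<noteq> \<infinity>)"
  \<comment> \<open>The shift by 1 keeps all radii positive, as the volume formula for balls
    requires.\<close>
  proof (intro exI[of _ "range (\<lambda>n::nat. cball (0::'a) (real n + 1))"] conjI)
    have "\<exists>n::nat. norm x \<le> real n + 1" for x :: 'a
      using real_arch_simple[of "norm x - 1"] by (simp only: diff_le_eq)
    then show "\<Union> (range (\<lambda>n. cball (0::'a) (real n + 1))) = space (onb_measure B)" by auto
    show "\<forall>a\<in>range (\<lambda>n. cball 0 (real n + 1)). emeasure (onb_measure B) a \<noteq> \<infinity>"
      using emeasure_onb_measure_cball[OF B] by (auto simp: add.commute)
  qed auto
qed

text \<open>Fubini in coordinates: \<open>merge\<close> identifies the product over \<open>B\<close>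
  times the product over \<open>C\<close> with the product over the disjoint union, and the basis
  expansions add up.\<close>

lemma onb_measure_Un:
  fixes B C :: "'a::euclidean_space set"
  assumes B: "orthonormal B" and C: "orthonormal C" and disj: "B \<inter> C = {}"
  shows "distr (onb_measure B \<Otimes>\<^sub>M onb_measure C) borel (\<lambda>(x, y). x + y) = onb_measure (B \<union> C)"
proof -
  interpret product_sigma_finite "\<lambda>_::'a. (lborel :: real measure)" ..
  have fin: "finite B" "finite C" using B C by (auto simp: orthonormal_def)
  let ?P = "\<lambda>B. \<Pi>\<^sub>M b\<in>B. (lborel :: real measure)" and ?s = "\<lambda>B c. \<Sum>b\<in>B. c b *\<^sub>R (b::'a)"
  have sf: "sigma_finite_measure (distr (?P C) borel (?s C))"
    using sigma_finite_onb_measure[OF C] by (simp add: onb_measure_def)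
  have "onb_measure B \<Otimes>\<^sub>M onb_measure C
      = distr (?P B \<Otimes>\<^sub>M ?P C) (borel \<Otimes>\<^sub>M borel) (\<lambda>(x, y). (?s B x, ?s C y))"
    unfolding onb_measure_def by (rule pair_measure_distr) (auto intro: sf)
  then have "distr (onb_measure B \<Otimes>\<^sub>M onb_measure C) borel (\<lambda>(x, y). x + y)
      = distr (?P B \<Otimes>\<^sub>M ?P C) borel ((\<lambda>(x, y). x + y) \<circ> (\<lambda>(x, y). (?s B x, ?s C y)))"
    by (simp add: distr_distr)
  also have "\<dots> = distr (?P B \<Otimes>\<^sub>M ?P C) borel (?s (B \<union> C) \<circ> merge B C)"
  proof (rule distr_cong)
    fix z :: "('a \<Rightarrow> real) \<times> ('a \<Rightarrow> real)"
    obtain x y where z: "z = (x, y)" by force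
    have "?s (B \<union> C) (merge B C (x, y)) = ?s B (merge B C (x, y)) + ?s C (merge B C (x, y))"
      using fin disj by (rule sum.union_disjoint)
    also have "?s B (merge B C (x, y)) = ?s B x" by (intro sum.cong) (auto simp: merge_def)
    also have "?s C (merge B C (x, y)) = ?s C y" using disj by (intro sum.cong) (auto simp: merge_def)
    finally show "((\<lambda>(x, y). x + y) \<circ> (\<lambda>(x, y). (?s B x, ?s C y))) z = (?s (B \<union> C) \<circ> merge B C) z"
      by (simp add: z)
  qed auto
  also have "\<dots> = distr (distr (?P B \<Otimes>\<^sub>M ?P C) (?P (B \<union> C)) (merge B C)) borel (?s (B \<union> C))"
    by (rule distr_distr[symmetric]) auto
  also have "\<dots> = onb_measure (B \<union> C)"
    by (simp add: distr_merge[OF disj fin] onb_measure_def)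
  finally show ?thesis .
qed

section \<open>Orthonormal bases of a subspace and of its orthogonal complement\<close>

lemma orthonormal_basis_ex:
  assumes "subspace \<alpha>"
  shows "\<exists>B. orthonormal_basis \<alpha> B"
  using orthonormal_basis_subspace[OF assms] unfolding orthonormal_basis_def by metis

text \<open>Unpacks the basis hidden in \<open>lborel_subspace\<close>. Orthonormal vectors are
  independent, which gives finiteness and the cardinality.\<close>

lemma lborel_subspace_onb:
  assumes "subspace \<alpha>"
  obtains B where "orthonormal B" "B \<subseteq> \<alpha>" "card B = dim \<alpha>" "lborel_subspace \<alpha> = onb_measure B"
proof
  let ?B = "SOME B. orthonormal_basis \<alpha> B"
  have B: "orthonormal_basis \<alpha> ?B" using orthonormal_basis_ex[OF assms] by (rule someI_ex)
  then have "independent ?B"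
    unfolding orthonormal_basis_def by (intro pairwise_orthogonal_independent) auto
  then show "orthonormal ?B"
    using B by (auto simp: orthonormal_basis_def orthonormal_def independent_imp_finite)
  have "dim (span ?B) = card ?B" using \<open>independent ?B\<close> by (simp add: dim_eq_card_independent)
  moreover have "span ?B = \<alpha>" using B unfolding orthonormal_basis_def by blast
  ultimately show "card ?B = dim \<alpha>" by simp
  show "?B \<subseteq> \<alpha>" using B by (simp add: orthonormal_basis_def)
  show "lborel_subspace \<alpha> = onb_measure ?B" by (simp add: lborel_subspace_def onb_measure_def Let_def)
qed

lemma dim_orthogonal_comp:
  fixes \<alpha> :: "'a::euclidean_space set"
  assumes "subspace \<alpha>"
  shows "dim (\<alpha>\<^sup>\<bottom>) + dim \<alpha> = DIM('a)"
  using dim_subspace_orthogonal_to_vectors[OF assms subspace_UNIV]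
  by (simp add: orthogonal_comp_def)

lemma sets_lborel_subspace [measurable_cong, simp]: "sets (lborel_subspace \<alpha>) = sets borel"
  by (simp add: lborel_subspace_def Let_def)

lemma space_lborel_subspace [simp]: "space (lborel_subspace \<alpha>) = UNIV"
  by (simp add: lborel_subspace_def Let_def)

lemma sigma_finite_lborel_subspace: "subspace \<alpha> \<Longrightarrow> sigma_finite_measure (lborel_subspace \<alpha>)"
  by (metis lborel_subspace_onb sigma_finite_onb_measure)

text \<open>The measure lives on the whole space. This allows identities valid only for points of
  \<alpha> to be used under the integral.\<close>

lemma AE_lborel_subspace:
  assumes "subspace \<alpha>"
  shows "AE x in lborel_subspace \<alpha>. x \<in> \<alpha>"
proof -
  obtain B where B: "B \<subseteq> \<alpha>" "lborel_subspace \<alpha> = onb_measure B"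
    using lborel_subspace_onb[OF assms] by metis
  have "{x. x \<in> \<alpha>} \<in> sets borel" using closed_subspace[OF assms] by simp
  then show ?thesis
    using B(1) unfolding B(2) onb_measure_def
    by (subst AE_distr_iff) (auto intro!: subspace_sum[OF assms] subspace_scale[OF assms])
qed

text \<open>Orthonormal bases of \<alpha> and \<open>\<alpha>\<^sup>\<bottom>\<close> are disjoint,
  since a common unit vector would be orthogonal to itself. By the dimension count their union is an
  orthonormal basis of the whole space.\<close>

lemma lborel_eq_subspace_sum:
  fixes \<alpha> :: "(real^'n::finite) set"
  assumes "subspace \<alpha>"
  shows "distr (lborel_subspace \<alpha> \<Otimes>\<^sub>M lborel_subspace (\<alpha>\<^sup>\<bottom>)) borel (\<lambda>(x, y). x + y) = lborel"
proof -
  obtain B where B: "orthonormal B" "B \<subseteq> \<alpha>" "card B = dim \<alpha>" "lborel_subspace \<alpha> = onb_measure B"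
    using lborel_subspace_onb[OF assms] .
  obtain C where C: "orthonormal C" "C \<subseteq> \<alpha>\<^sup>\<bottom>" "card C = dim (\<alpha>\<^sup>\<bottom>)" "lborel_subspace (\<alpha>\<^sup>\<bottom>) = onb_measure C"
    using lborel_subspace_onb[OF subspace_orthogonal_comp] .
  have BC: "orthogonal b c" if "b \<in> B" "c \<in> C" for b c
    using that B(2) C(2) by (auto simp: orthogonal_comp_def)
  have disj: "B \<inter> C = {}"
  proof (rule ccontr)
    assume "B \<inter> C \<noteq> {}"
    then obtain b where "b \<in> B" "b \<in> C" by auto
    then have "orthogonal b b" "norm b = 1" using BC B(1) by (auto simp: orthonormal_def)
    then show False by (simp add: orthogonal_self)
  qed
  have on: "orthonormal (B \<union> C)"
    using B(1) C(1) BC unfolding orthonormal_def pairwise_def by (metis UnE finite_UnI orthogonal_commute)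
  have "card (B \<union> C) = DIM(real^'n)"
    using B(1,3) C(1,3) disj dim_orthogonal_comp[OF assms]
    by (subst card_Un_disjoint) (auto simp: orthonormal_def add.commute)
  with onb_measure_Un[OF B(1) C(1) disj] onb_measure_UNIV[OF on] show ?thesis
    by (simp add: B(4) C(4))
qed

section \<open>Integration of radial functions\<close>

lemma sphere_area_pos: "sphere_area m > 0"
  by (simp add: sphere_area_def Gamma_real_pos)

text \<open>The functional equation of \<open>Gamma\<close> at \<open>m / 2\<close>. It makes the
  sphere area the derivative of the ball volume in the radius, at radius 1.\<close>

lemma unit_ball_vol_sphere_area: "m > 0 \<Longrightarrow> real m * unit_ball_vol (real m) = sphere_area (m - 1)"
proof -
  assume m: "m > 0"
  have Gam: "Gamma (real m / 2 + 1) = real m / 2 * Gamma (real m / 2)"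
    using m by (intro Gamma_plus1) (auto simp: nonpos_Ints_def)
  have "Gamma (real m / 2) > 0" using m by (intro Gamma_real_pos) simp
  moreover have "real (m - 1 + 1) = real m" using m by simp
  ultimately show ?thesis using m unfolding unit_ball_vol_def sphere_area_def Gam
    by (simp del: Suc_pred)
qed

text \<open>Polar coordinates for radial functions. The half-lines \<open>{..r}\<close> generate the
  Borel sets; on them the left side is the volume of a ball, and the right side integrates the
  density back to this volume.\<close>

lemma distr_norm_onb_measure:
  fixes B :: "'a::euclidean_space set"
  assumes B: "orthonormal B" and m: "card B = m" "m > 0"
  shows "distr (onb_measure B) borel norm
    = density lborel (\<lambda>r. ennreal (sphere_area (m - 1) * r ^ (m - 1)) * indicator {0..} r)"
proof (rule measure_eqI_generator_eq_countable[where E = "range (\<lambda>r. {..r::real})"])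
  let ?L = "distr (onb_measure B) borel norm"
  let ?R = "density lborel (\<lambda>r. ennreal (sphere_area (m - 1) * r ^ (m - 1)) * indicator {0..} r)"
  note pos = less_imp_le[OF sphere_area_pos[of "m - 1"]]
  have L: "emeasure ?L {..r} = ennreal (unit_ball_vol (real m) * (max 0 r) ^ m)" for r
  proof -
    have eq: "emeasure ?L {..r} = emeasure (onb_measure B) (cball 0 r)" for r
      by (subst emeasure_distr) (auto simp: vimage_def cball_def)
    consider "r > 0" | "r < 0" | "r = 0" by linarith
    then show ?thesis
    proof cases
      case 1 then show ?thesis using emeasure_onb_measure_cball[OF B, of r] m by (simp add: eq max_def)
    next
      case 2 then show ?thesis using m by (simp add: eq max_def)
    next
      case 3
      \<comment> \<open>The volume formula covers positive radii only. The origin lies in every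
        small ball, so its measure is at most the limit 0 of their volumes.\<close>
      have "emeasure (onb_measure B) {0} \<le> ennreal (unit_ball_vol (real m) * e ^ m)" if "e > 0" for e
      proof -
        have "emeasure (onb_measure B) {0} \<le> emeasure (onb_measure B) (cball 0 e)"
          using that by (intro emeasure_mono) auto
        then show ?thesis using emeasure_onb_measure_cball[OF B that] m by simp
      qed
      moreover have "((\<lambda>e. ennreal (unit_ball_vol (real m) * e ^ m)) \<longlongrightarrow> ennreal (unit_ball_vol (real m) * 0 ^ m)) (at_right 0)"
        by (intro tendsto_intros)
      ultimately have "emeasure (onb_measure B) {0} \<le> ennreal (unit_ball_vol (real m) * 0 ^ m)"
        by (intro tendsto_lowerbound[where F = "at_right (0::real)"]) (auto simp: eventually_at_right_less intro: eventually_mono[OF eventually_at_right_less])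
      then show ?thesis using m 3 by (simp add: eq zero_power)
    qed
  qed
  have R: "emeasure ?R {..r} = ennreal (unit_ball_vol (real m) * (max 0 r) ^ m)" for r
  proof -
    have "emeasure ?R {..r} = (\<integral>\<^sup>+x. ennreal (sphere_area (m - 1) * x ^ (m - 1)) * indicator {0..max 0 r} x \<partial>lborel)"
    proof (subst emeasure_density)
      \<comment> \<open>For negative \<open>r\<close> the interval \<open>{0..max 0 r}\<close> is
        the single point 0 while the left integrand vanishes; the discrepancy is a null set.\<close>
      have "AE x in lborel. x \<noteq> (0::real)" by (rule AE_lborel_singleton)
      then show "(\<integral>\<^sup>+x. ennreal (sphere_area (m - 1) * x ^ (m - 1)) * indicator {0..} x * indicator {..r} x \<partial>lborel)
          = (\<integral>\<^sup>+x. ennreal (sphere_area (m - 1) * x ^ (m - 1)) * indicator {0..max 0 r} x \<partial>lborel)"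
        by (intro nn_integral_cong_AE) (auto simp: indicator_def max_def)
    qed auto
    also have "\<dots> = ennreal (unit_ball_vol (real m) * (max 0 r) ^ m - unit_ball_vol (real m) * 0 ^ m)"
    proof (rule nn_integral_FTC_Icc)
      fix x :: real assume x: "x \<in> {0..max 0 r}"
      show "((\<lambda>x. unit_ball_vol (real m) * x ^ m) has_real_derivative sphere_area (m - 1) * x ^ (m - 1)) (at x)"
        unfolding unit_ball_vol_sphere_area[OF m(2), symmetric]
        by (auto intro!: derivative_eq_intros)
      show "0 \<le> sphere_area (m - 1) * x ^ (m - 1)" using pos x by simp
    qed auto
    finally show ?thesis using m by simp
  qed
  show "emeasure ?L X = emeasure ?R X" if "X \<in> range (\<lambda>r. {..r::real})" for X using that L R by auto
  show "Int_stable (range (\<lambda>r. {..r::real}))" by (auto simp: Int_stable_def)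
  show "sets ?L = sigma_sets UNIV (range (\<lambda>r. {..r::real}))" "sets ?R = sigma_sets UNIV (range (\<lambda>r. {..r::real}))"
    by (simp_all add: borel_eq_atMost)
  show "countable (range (\<lambda>n::nat. {..real n}))" "range (\<lambda>n::nat. {..real n}) \<subseteq> range (\<lambda>r. {..r::real})" by auto
  have "\<exists>n. x \<le> real n" for x by (rule real_arch_simple)
  then show "\<Union> (range (\<lambda>n::nat. {..real n})) = UNIV" by auto
  show "emeasure ?L X \<noteq> \<infinity>" if "X \<in> range (\<lambda>n::nat. {..real n})" for X using that L by auto
qed auto

lemma nn_integral_lborel_subspace_norm:
  fixes h :: "real \<Rightarrow> ennreal"
  assumes \<alpha>: "subspace \<alpha>" "dim \<alpha> = m" "m > 0" and [measurable]: "h \<in> borel_measurable borel"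
  shows "(\<integral>\<^sup>+x. h (norm x) \<partial>lborel_subspace \<alpha>)
    = ennreal (sphere_area (m - 1)) * (\<integral>\<^sup>+r. ennreal (r ^ (m - 1)) * indicator {0..} r * h r \<partial>lborel)"
proof -
  obtain B where B: "orthonormal B" "card B = m" "lborel_subspace \<alpha> = onb_measure B"
    using lborel_subspace_onb[OF \<alpha>(1)] \<alpha>(2) by metis
  have "(\<integral>\<^sup>+x. h (norm x) \<partial>lborel_subspace \<alpha>) = (\<integral>\<^sup>+r. h r \<partial>distr (onb_measure B) borel norm)"
    unfolding B(3) by (subst nn_integral_distr) auto
  also have "\<dots> = (\<integral>\<^sup>+r. ennreal (sphere_area (m - 1) * r ^ (m - 1)) * indicator {0..} r * h r \<partial>lborel)"
    unfolding distr_norm_onb_measure[OF B(1,2) \<alpha>(3)] by (subst nn_integral_density) auto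
  also have "\<dots> = (\<integral>\<^sup>+r. ennreal (sphere_area (m - 1)) * (ennreal (r ^ (m - 1)) * indicator {0..} r * h r) \<partial>lborel)"
    by (intro nn_integral_cong) (simp add: indicator_def ennreal_mult less_imp_le[OF sphere_area_pos] mult.assoc)
  also have "\<dots> = ennreal (sphere_area (m - 1)) * (\<integral>\<^sup>+r. ennreal (r ^ (m - 1)) * indicator {0..} r * h r \<partial>lborel)"
    by (rule nn_integral_cmult) measurable
  finally show ?thesis .
qed

text \<open>Makes the radial integration formula for subspaces available on the whole space.\<close>

lemma lborel_subspace_UNIV: "lborel_subspace (UNIV :: (real^'n::finite) set) = lborel"
proof -
  obtain B :: "(real^'n) set" where "orthonormal B" "card B = dim (UNIV :: (real^'n) set)" "lborel_subspace UNIV = onb_measure B"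
    using lborel_subspace_onb[OF subspace_UNIV] by metis
  then show ?thesis using onb_measure_UNIV[of B] by simp
qed

lemma nn_integral_lborel_split:
  fixes \<alpha> :: "(real^'n::finite) set"
  assumes \<alpha>: "subspace \<alpha>" and [measurable]: "h \<in> borel_measurable borel"
  shows "(\<integral>\<^sup>+z. h z \<partial>lborel) = (\<integral>\<^sup>+y. (\<integral>\<^sup>+x. h (x + y) \<partial>lborel_subspace \<alpha>) \<partial>lborel_subspace (\<alpha>\<^sup>\<bottom>))"
proof -
  interpret pair_sigma_finite "lborel_subspace \<alpha>" "lborel_subspace (\<alpha>\<^sup>\<bottom>)"
    unfolding pair_sigma_finite_def
    using \<alpha> subspace_orthogonal_comp sigma_finite_lborel_subspace by blast
  have "(\<integral>\<^sup>+z. h z \<partial>lborel) = (\<integral>\<^sup>+p. h (fst p + snd p) \<partial>(lborel_subspace \<alpha> \<Otimes>\<^sub>M lborel_subspace (\<alpha>\<^sup>\<bottom>)))"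
    by (subst lborel_eq_subspace_sum[OF \<alpha>, symmetric], subst nn_integral_distr) (auto simp: case_prod_beta')
  also have "\<dots> = (\<integral>\<^sup>+y. (\<integral>\<^sup>+x. h (x + y) \<partial>lborel_subspace \<alpha>) \<partial>lborel_subspace (\<alpha>\<^sup>\<bottom>))"
    by (subst nn_integral_snd[symmetric]) auto
  finally show ?thesis .
qed

section \<open>Integration over orthogonal complements\<close>

lemma closest_point_subspace_add:
  fixes \<alpha> :: "'a::euclidean_space set"
  assumes "subspace \<alpha>" "x \<in> \<alpha>" "y \<in> \<alpha>\<^sup>\<bottom>"
  shows "closest_point \<alpha> (x + y) = x"
  using assms by (intro closest_point_subspaceI) (auto simp: orthogonal_comp_def orthogonal_def inner_commute)

lemma borel_measurable_linear:
  fixes T :: "'a::euclidean_space \<Rightarrow> 'b::euclidean_space"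
  shows "linear T \<Longrightarrow> T \<in> borel_measurable borel"
  by (intro borel_measurable_continuous_onI linear_continuous_on) (simp add: linear_conv_bounded_linear)

lemma unit_cball_borel [measurable]: "cball (0 :: 'a::euclidean_space) 1 \<in> sets borel"
  by simp

text \<open>
  Rewriting the integral over \<open>\<alpha>\<^sup>\<bottom>\<close> as one over the whole space makes it depend on \<open>\<alpha>\<close> only
  through the orthogonal projection, which is what the \<open>\<sigma>\<close>-algebra on the Grassmannian controls.
\<close>

lemma nn_integral_orthogonal_comp:
  fixes \<alpha> :: "(real^'n::finite) set"
  assumes \<alpha>: "subspace \<alpha>" "dim \<alpha> = k" and [measurable]: "h \<in> borel_measurable borel"
  shows "ennreal (unit_ball_vol (real k)) * (\<integral>\<^sup>+\<eta>. h \<eta> \<partial>lborel_subspace (\<alpha>\<^sup>\<bottom>))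
    = (\<integral>\<^sup>+x. h (x - closest_point \<alpha> x) * indicator (cball 0 1) (closest_point \<alpha> x) \<partial>lborel)"
proof -
  have [measurable]: "closest_point \<alpha> \<in> borel_measurable borel"
    by (intro borel_measurable_linear linear_closest_point_subspace \<alpha>)
  obtain B where B: "orthonormal B" "card B = k" "lborel_subspace \<alpha> = onb_measure B"
    using lborel_subspace_onb[OF \<alpha>(1)] \<alpha>(2) by metis
  have "(\<integral>\<^sup>+x. h (x - closest_point \<alpha> x) * indicator (cball 0 1) (closest_point \<alpha> x) \<partial>lborel)
      = (\<integral>\<^sup>+y. (\<integral>\<^sup>+x. h (x + y - closest_point \<alpha> (x + y)) * indicator (cball 0 1) (closest_point \<alpha> (x + y))
          \<partial>lborel_subspace \<alpha>) \<partial>lborel_subspace (\<alpha>\<^sup>\<bottom>))"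
    by (rule nn_integral_lborel_split[OF \<alpha>(1)]) measurable
  \<comment> \<open>For \<open>x\<close> in \<alpha> and \<open>y\<close> in the complement, the
    projection of \<open>x + y\<close> is \<open>x\<close>. The inner integral therefore splits off
    the volume of the unit ball of \<alpha>.\<close>
  also have "\<dots> = (\<integral>\<^sup>+y. (\<integral>\<^sup>+x. h y * indicator (cball 0 1) x \<partial>lborel_subspace \<alpha>) \<partial>lborel_subspace (\<alpha>\<^sup>\<bottom>))"
  proof (rule nn_integral_cong_AE)
    show "AE y in lborel_subspace (\<alpha>\<^sup>\<bottom>).
        (\<integral>\<^sup>+x. h (x + y - closest_point \<alpha> (x + y)) * indicator (cball 0 1) (closest_point \<alpha> (x + y)) \<partial>lborel_subspace \<alpha>)
        = (\<integral>\<^sup>+x. h y * indicator (cball 0 1) x \<partial>lborel_subspace \<alpha>)"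
      using AE_lborel_subspace[OF subspace_orthogonal_comp]
    proof eventually_elim
      case (elim y)
      show ?case
        using AE_lborel_subspace[OF \<alpha>(1)]
        by (intro nn_integral_cong_AE) (auto elim!: eventually_mono simp: closest_point_subspace_add[OF \<alpha>(1) _ elim])
    qed
  qed
  also have "\<dots> = (\<integral>\<^sup>+y. h y * ennreal (unit_ball_vol (real k)) \<partial>lborel_subspace (\<alpha>\<^sup>\<bottom>))"
    using emeasure_onb_measure_cball[OF B(1), of 1]
    by (intro nn_integral_cong) (simp add: nn_integral_cmult B)
  also have "\<dots> = ennreal (unit_ball_vol (real k)) * (\<integral>\<^sup>+\<eta>. h \<eta> \<partial>lborel_subspace (\<alpha>\<^sup>\<bottom>))"
    by (subst nn_integral_multc) (auto simp: mult.commute)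
  finally show ?thesis by simp
qed

lemma nn_integral_orthogonal_comp':
  fixes \<alpha> :: "(real^'n::finite) set"
  assumes \<alpha>: "subspace \<alpha>" "dim \<alpha> = k" and h: "h \<in> borel_measurable borel"
  shows "(\<integral>\<^sup>+\<eta>. h \<eta> \<partial>lborel_subspace (\<alpha>\<^sup>\<bottom>))
    = (\<integral>\<^sup>+x. h (x - closest_point \<alpha> x) * indicator (cball 0 1) (closest_point \<alpha> x) \<partial>lborel)
        / ennreal (unit_ball_vol (real k))"
  unfolding nn_integral_orthogonal_comp[OF assms, symmetric]
  using less_imp_neq[OF unit_ball_vol_pos[of "real k"]]
  by (subst mult.commute, subst ennreal_mult_divide_eq) (simp_all add: ennreal_eq_0_iff not_le)

text \<open>The matrix of the projection is measurable by the choice of the \<sigma>-algebra, and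
  applying a matrix to a vector is jointly continuous.\<close>

lemma measurable_closest_point_grassmannian:
  "(\<lambda>(\<alpha>, x). closest_point \<alpha> (x :: real^'n::finite)) \<in> borel_measurable (grassmannian_borel k \<Otimes>\<^sub>M borel)"
proof -
  have [measurable]: "(\<lambda>\<alpha>::(real^'n) set. matrix (closest_point \<alpha>)) \<in> borel_measurable (grassmannian_borel k)"
    unfolding grassmannian_borel_def by (rule measurable_vimage_algebra1) auto
  have "continuous_on UNIV (\<lambda>(A::real^'n^'n, x). A *v x)"
    unfolding matrix_vector_mult_def case_prod_beta' by (intro continuous_intros)
  then have "(\<lambda>(A::real^'n^'n, x). A *v x) \<in> borel_measurable (borel \<Otimes>\<^sub>M borel)"
    unfolding borel_prod by (rule borel_measurable_continuous_onI)
  then have "(\<lambda>z. (\<lambda>(A::real^'n^'n, x). A *v x) (matrix (closest_point (fst z)), snd z))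
      \<in> borel_measurable (grassmannian_borel k \<Otimes>\<^sub>M borel)"
    by (rule measurable_compose[rotated]) measurable
  moreover have "closest_point \<alpha> x = matrix (closest_point \<alpha>) *v x" if "\<alpha> \<in> space (grassmannian_borel k)" for \<alpha> x
    using that matrix_vector_mul(2)[OF linear_closest_point_subspace, of \<alpha>]
    by (simp add: grassmannian_borel_def grassmannian_def)
  ultimately show ?thesis
    by (subst measurable_cong[where g = "\<lambda>z. (\<lambda>(A::real^'n^'n, x). A *v x) (matrix (closest_point (fst z)), snd z)"])
      (auto simp: space_pair_measure)
qed

lemma space_grassmannian_borel [simp]: "space (grassmannian_borel k) = grassmannian k"
  by (simp add: grassmannian_borel_def)

text \<open>The measure of integration varies with \<open>z\<close>. Over the whole space the
  measure becomes fixed and only the integrand varies, measurably. The parameter \<open>z\<close> is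
  needed to exchange the integrals over \<alpha> and over a random rotation.\<close>

lemma measurable_nn_integral_orthogonal_comp:
  fixes \<alpha> :: "'a \<Rightarrow> (real^'n::finite) set"
  assumes \<alpha>[measurable]: "\<alpha> \<in> N \<rightarrow>\<^sub>M grassmannian_borel k"
    and h[measurable]: "(\<lambda>(z, \<eta>). h z \<eta>) \<in> borel_measurable (N \<Otimes>\<^sub>M borel)"
  shows "(\<lambda>z. \<integral>\<^sup>+\<eta>. h z \<eta> \<partial>lborel_subspace ((\<alpha> z)\<^sup>\<bottom>)) \<in> borel_measurable N"
proof -
  have "(\<lambda>p. (\<lambda>(\<alpha>, x). closest_point \<alpha> x) (\<alpha> (fst p), snd p)) \<in> borel_measurable (N \<Otimes>\<^sub>M borel)"
    by (rule measurable_compose[OF _ measurable_closest_point_grassmannian]) measurable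
  then have [measurable]: "(\<lambda>p. closest_point (\<alpha> (fst p)) (snd p)) \<in> borel_measurable (N \<Otimes>\<^sub>M borel)"
    by simp
  have "(\<lambda>p. (\<lambda>(z, \<eta>). h z \<eta>) (fst p, snd p - closest_point (\<alpha> (fst p)) (snd p))) \<in> borel_measurable (N \<Otimes>\<^sub>M borel)"
    by (rule measurable_compose[OF _ h]) measurable
  then have [measurable]: "(\<lambda>p. h (fst p) (snd p - closest_point (\<alpha> (fst p)) (snd p))) \<in> borel_measurable (N \<Otimes>\<^sub>M borel)"
    by simp
  have "(\<lambda>z. (\<integral>\<^sup>+x. h z (x - closest_point (\<alpha> z) x) * indicator (cball 0 1) (closest_point (\<alpha> z) x) \<partial>lborel)
        / ennreal (unit_ball_vol (real k))) \<in> borel_measurable N"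
    by (intro borel_measurable_divide_ennreal borel_measurable_const lborel.borel_measurable_nn_integral)
      (simp add: case_prod_beta')
  moreover have "(\<integral>\<^sup>+\<eta>. h z \<eta> \<partial>lborel_subspace ((\<alpha> z)\<^sup>\<bottom>))
    = (\<integral>\<^sup>+x. h z (x - closest_point (\<alpha> z) x) * indicator (cball 0 1) (closest_point (\<alpha> z) x) \<partial>lborel)
        / ennreal (unit_ball_vol (real k))" if z: "z \<in> space N" for z
  proof (rule nn_integral_orthogonal_comp')
    show "subspace (\<alpha> z)" "dim (\<alpha> z) = k"
      using measurable_space[OF \<alpha> z] by (auto simp: grassmannian_def)
    show "h z \<in> borel_measurable borel"
      using measurable_Pair2[OF h z] by simp
  qed
  ultimately show ?thesis by (subst measurable_cong) 
qed

lemma closest_point_image: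
  fixes T :: "'a::euclidean_space \<Rightarrow> 'a"
  assumes T: "orthogonal_transformation T" and \<alpha>: "subspace \<alpha>"
  shows "closest_point (T ` \<alpha>) (T x) = T (closest_point \<alpha> x)"
proof (rule closest_point_subspaceI)
  have lin: "linear T" using T by (rule orthogonal_transformation_linear)
  show "subspace (T ` \<alpha>)" using lin \<alpha> by (rule linear_subspace_image)
  show "T (closest_point \<alpha> x) \<in> T ` \<alpha>" using closest_point_subspace(1)[OF \<alpha>] by blast
  show "(T x - T (closest_point \<alpha> x)) \<bullet> z = 0" if "z \<in> T ` \<alpha>" for z
    using that closest_point_subspace(2)[OF \<alpha>] T
    by (auto simp flip: linear_diff[OF lin] simp: orthogonal_transformation_def)
qed

text \<open>\<open>T\<close> maps the complement of \<alpha> isometrically onto the complement of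
  the image. Written over the whole space this is the invariance of \<open>lborel\<close> under
  \<open>T\<close>, so no bases have to be compared.\<close>

lemma nn_integral_orthogonal_comp_image:
  fixes \<alpha> :: "(real^'n::finite) set"
  assumes \<alpha>: "subspace \<alpha>" and T: "orthogonal_transformation (T :: real^'n \<Rightarrow> real^'n)" and [measurable]: "h \<in> borel_measurable borel"
  shows "(\<integral>\<^sup>+\<eta>. h (T \<eta>) \<partial>lborel_subspace (\<alpha>\<^sup>\<bottom>)) = (\<integral>\<^sup>+\<eta>. h \<eta> \<partial>lborel_subspace ((T ` \<alpha>)\<^sup>\<bottom>))"
proof -
  have lin: "linear T" using T by (rule orthogonal_transformation_linear)
  note [measurable] = borel_measurable_linear[OF lin]
  have G: "T ` \<alpha> \<in> grassmannian (dim \<alpha>)"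
    using \<alpha> by (intro image_grassmannian T) (simp add: grassmannian_def)
  have [measurable]: "closest_point (T ` \<alpha>) \<in> borel_measurable borel"
    using G by (intro borel_measurable_linear linear_closest_point_subspace) (simp add: grassmannian_def)
  have "(\<integral>\<^sup>+x. h (x - closest_point (T ` \<alpha>) x) * indicator (cball 0 1) (closest_point (T ` \<alpha>) x) \<partial>lborel)
      = (\<integral>\<^sup>+x. h (T x - closest_point (T ` \<alpha>) (T x)) * indicator (cball 0 1) (closest_point (T ` \<alpha>) (T x)) \<partial>lborel)"
    by (subst lborel_distr_orthogonal[OF T, symmetric], subst nn_integral_distr) auto
  also have "\<dots> = (\<integral>\<^sup>+x. h (T (x - closest_point \<alpha> x)) * indicator (cball 0 1) (closest_point \<alpha> x) \<partial>lborel)"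
    using T by (simp add: closest_point_image[OF T \<alpha>] linear_diff[OF lin] indicator_def orthogonal_transformation)
  finally show ?thesis
    using G \<alpha> by (simp add: nn_integral_orthogonal_comp'[where k = "dim \<alpha>"] grassmannian_def)
qed

section \<open>The Fourier slice theorem\<close>

text \<open>Decay of order \<open>d + 1\<close> gives a radial majorant, which is integrated in
  polar coordinates.\<close>

lemma schwartz_integrable:
  fixes f :: "real^'n::finite \<Rightarrow> complex"
  assumes "schwartz f"
  shows "integrable lborel f"
proof -
  let ?d = "CARD('n)"
  \<comment> \<open>The empty list of indices yields \<open>f\<close> itself, here and in the decay
    bound below.\<close>
  have "f differentiable (at x)" for x
    using assms unfolding schwartz_def iterated_partial_def by (metis foldr.simps(1) id_apply)
  then have "continuous_on UNIV f"
    by (simp add: continuous_on_eq_continuous_within differentiable_imp_continuous_within)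
  then have [measurable]: "f \<in> borel_measurable borel" by (rule borel_measurable_continuous_onI)
  have bdd: "bounded (range (\<lambda>x. norm x ^ N *\<^sub>R f x))" for N
    using assms unfolding schwartz_def iterated_partial_def by (metis foldr.simps(1) id_apply)
  obtain A where A: "\<And>x. cmod (f x) \<le> A" using bdd[of 0] by (auto simp: bounded_iff)
  obtain B where B: "\<And>x. norm x ^ (?d + 1) * cmod (f x) \<le> B"
    using bdd[of "?d + 1"] by (auto simp: bounded_iff)
  have AB: "A + B \<ge> 0" using A[of 0] B[of 0] norm_ge_zero[of "f 0"] by (simp del: norm_ge_zero)
  have bound: "cmod (f x) \<le> (A + B) / (1 + norm x ^ (?d + 1))" for x
  proof -
    have "cmod (f x) * (1 + norm x ^ (?d + 1)) \<le> A + B"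
      using A[of x] B[of x] by (simp add: algebra_simps)
    moreover have "1 + norm x ^ (?d + 1) > 0" by (intro add_pos_nonneg) auto
    ultimately show ?thesis by (simp add: pos_le_divide_eq)
  qed
  \<comment> \<open>The density \<open>r ^ (d - 1)\<close> of polar coordinates leaves decay of
    order 2, dominated by a multiple of the derivative of \<open>arctan\<close>.\<close>
  have radial: "r ^ (?d - 1) * ((A + B) / (1 + r ^ (?d + 1))) \<le> 2 * (A + B) * (1 / (1 + r\<^sup>2))" if r: "0 \<le> r" for r :: real
  proof -
    have "r ^ (?d - 1) \<le> 1 + r ^ (?d + 1)"
    proof (cases "r \<le> 1")
      case True then show ?thesis using r power_le_one[of r "?d - 1"] by (simp add: add_increasing2)
    next
      case False then have "r ^ (?d - 1) \<le> r ^ (?d + 1)" by (intro power_increasing) auto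
      then show ?thesis by simp
    qed
    moreover have "r ^ (?d - 1) * r\<^sup>2 = r ^ (?d + 1)"
      unfolding power_add[symmetric] by (rule arg_cong[of _ _ "power r"]) (simp add: Suc_leI)
    ultimately have "r ^ (?d - 1) * (1 + r\<^sup>2) \<le> 2 * (1 + r ^ (?d + 1))" using r by (simp add: algebra_simps)
    from mult_left_mono[OF this AB] 
    have *: "(A + B) * (r ^ (?d - 1) * (1 + r\<^sup>2)) \<le> (A + B) * (2 * (1 + r ^ (?d + 1)))" .
    have pos: "1 + r ^ (?d + 1) > 0" "1 + r\<^sup>2 > 0" using r by (auto intro: add_pos_nonneg)
    have "(r ^ (?d - 1) * (A + B)) * (1 + r\<^sup>2) \<le> (2 * (A + B)) * (1 + r ^ (?d + 1))"
      using * by (simp only: mult_ac)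
    then have "(r ^ (?d - 1) * (A + B)) / (1 + r ^ (?d + 1)) \<le> (2 * (A + B)) / (1 + r\<^sup>2)"
      using pos by (simp only: pos_divide_le_eq pos_le_divide_eq times_divide_eq_left)
    then show ?thesis by simp
  qed
  have "(\<integral>\<^sup>+x. ennreal (cmod (f x)) \<partial>lborel) \<le> (\<integral>\<^sup>+x. ennreal ((A + B) / (1 + norm (x::real^'n) ^ (?d + 1))) \<partial>lborel)"
    by (intro nn_integral_mono ennreal_leI bound)
  also have "\<dots> = ennreal (sphere_area (?d - 1)) *
      (\<integral>\<^sup>+r. ennreal (r ^ (?d - 1)) * indicator {0..} r * ennreal ((A + B) / (1 + r ^ (?d + 1))) \<partial>lborel)"
    by (subst lborel_subspace_UNIV[symmetric], rule nn_integral_lborel_subspace_norm) auto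
  also have "\<dots> \<le> ennreal (sphere_area (?d - 1)) * (\<integral>\<^sup>+r. ennreal (2 * (A + B)) * (ennreal (1 / (1 + r\<^sup>2)) * indicator {0..} r) \<partial>lborel)"
  proof (intro mult_left_mono nn_integral_mono)
    fix r :: real
    show "ennreal (r ^ (?d - 1)) * indicator {0..} r * ennreal ((A + B) / (1 + r ^ (?d + 1)))
        \<le> ennreal (2 * (A + B)) * (ennreal (1 / (1 + r\<^sup>2)) * indicator {0..} r)"
    proof (cases "r \<ge> 0")
      case True
      then have "ennreal (r ^ (?d - 1)) * ennreal ((A + B) / (1 + r ^ (?d + 1)))
          = ennreal (r ^ (?d - 1) * ((A + B) / (1 + r ^ (?d + 1))))"
        using AB by (intro ennreal_mult[symmetric]) auto
      also have "\<dots> \<le> ennreal (2 * (A + B) * (1 / (1 + r\<^sup>2)))"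
        by (intro ennreal_leI radial True)
      also have "\<dots> = ennreal (2 * (A + B)) * ennreal (1 / (1 + r\<^sup>2))"
        using AB by (intro ennreal_mult) auto
      finally show ?thesis using True by simp
    qed simp
  qed simp
  also have "\<dots> = ennreal (sphere_area (?d - 1)) * (ennreal (2 * (A + B)) * (\<integral>\<^sup>+r. ennreal (1 / (1 + r\<^sup>2)) * indicator {0..} r \<partial>lborel))"
    by (subst nn_integral_cmult) auto
  also have "(\<integral>\<^sup>+r. ennreal (1 / (1 + r\<^sup>2)) * indicator {0..} r \<partial>lborel) = ennreal (pi / 2 - arctan 0)"
    by (rule nn_integral_FTC_atLeast) (auto intro!: derivative_eq_intros tendsto_arctan_at_top simp: field_simps add_nonneg_nonneg)
  finally have "(\<integral>\<^sup>+x. ennreal (cmod (f x)) \<partial>lborel) < \<infinity>"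
    by (rule order_le_less_trans) (simp add: ennreal_mult_less_top)
  then show ?thesis by (intro integrableI_bounded) auto
qed

text \<open>For \<eta> orthogonal to \<alpha> the phase is constant along translates of \<alpha>, so
  Fubini on the sum of \<alpha> and its complement applies. The factor compares the normalizations
  in dimensions \<open>d\<close> and \<open>d - k\<close>.\<close>

lemma fiber_fourier_k_plane_transform:
  fixes f :: "real^'n::finite \<Rightarrow> complex"
  assumes f: "schwartz f" and \<alpha>: "subspace \<alpha>" and \<eta>: "\<eta> \<in> \<alpha>\<^sup>\<bottom>"
  shows "fiber_fourier k (k_plane_transform f) \<alpha> \<eta> = complex_of_real ((2 * pi) powr (real k / 2)) * fourier f \<eta>"
proof -
  interpret pair_sigma_finite "lborel_subspace \<alpha>" "lborel_subspace (\<alpha>\<^sup>\<bottom>)"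
    unfolding pair_sigma_finite_def
    using \<alpha> subspace_orthogonal_comp sigma_finite_lborel_subspace by blast
  have int: "integrable lborel f" using f by (rule schwartz_integrable)
  then have [measurable]: "f \<in> borel_measurable borel" by simp
  define F where "F z = exp (- \<i> * complex_of_real (z \<bullet> \<eta>)) * f z" for z
  have [measurable]: "F \<in> borel_measurable borel" unfolding F_def by measurable
  have F: "integrable lborel F"
  proof (rule Bochner_Integration.integrable_bound[OF int])
    show "AE x in lborel. norm (F x) \<le> norm (f x)" by (simp add: F_def norm_mult)
  qed simp
  then have "integrable (distr (lborel_subspace \<alpha> \<Otimes>\<^sub>M lborel_subspace (\<alpha>\<^sup>\<bottom>)) borel (\<lambda>(x, y). x + y)) F"
    by (simp add: lborel_eq_subspace_sum[OF \<alpha>])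
  then have F': "integrable (lborel_subspace \<alpha> \<Otimes>\<^sub>M lborel_subspace (\<alpha>\<^sup>\<bottom>)) (\<lambda>(x, y). F (x + y))"
    by (subst (asm) integrable_distr_eq) (auto simp: case_prod_beta')
  have "(LINT z|lborel. F z) = (LINT p|(lborel_subspace \<alpha> \<Otimes>\<^sub>M lborel_subspace (\<alpha>\<^sup>\<bottom>)). (\<lambda>(x, y). F (x + y)) p)"
    by (subst lborel_eq_subspace_sum[OF \<alpha>, symmetric], subst integral_distr) (auto simp: case_prod_beta')
  also have "\<dots> = (LINT y|lborel_subspace (\<alpha>\<^sup>\<bottom>). LINT x|lborel_subspace \<alpha>. F (x + y))"
    by (rule integral_snd[OF F', symmetric])
  also have "\<dots> = (LINT y|lborel_subspace (\<alpha>\<^sup>\<bottom>). exp (- \<i> * complex_of_real (y \<bullet> \<eta>)) * k_plane_transform f \<alpha> y)"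
  \<comment> \<open>The equality holds for every \<open>y\<close>: where the slice of
    \<open>f\<close> is not integrable, both sides take the default value 0 of the Bochner
    integral.\<close>
  proof (rule Bochner_Integration.integral_cong[OF refl])
    fix y
    have "(LINT x|lborel_subspace \<alpha>. F (x + y))
        = (LINT x|lborel_subspace \<alpha>. exp (- \<i> * complex_of_real (y \<bullet> \<eta>)) * f (x + y))"
    proof (rule integral_cong_AE)
      show "AE x in lborel_subspace \<alpha>. F (x + y) = exp (- \<i> * complex_of_real (y \<bullet> \<eta>)) * f (x + y)"
        using AE_lborel_subspace[OF \<alpha>]
      proof eventually_elim
        case (elim x)
        then have "x \<bullet> \<eta> = 0" using \<eta> by (simp add: orthogonal_comp_def orthogonal_def)
        then show ?case by (simp add: F_def inner_add_left)
      qed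
    qed measurable
    then show "(LINT x|lborel_subspace \<alpha>. F (x + y)) = exp (- \<i> * complex_of_real (y \<bullet> \<eta>)) * k_plane_transform f \<alpha> y"
      by (simp add: k_plane_transform_def)
  qed
  finally have "(LINT z|lborel. F z) = \<dots>" .
  moreover have "(2 * pi) powr (- (real CARD('n) - real k) / 2)
      = (2 * pi) powr (real k / 2) * (2 * pi) powr (- real CARD('n) / 2)"
    by (simp add: powr_add[symmetric] field_simps)
  ultimately show ?thesis
    by (simp add: fiber_fourier_def fourier_def F_def mult.assoc)
qed

section \<open>Random rotations\<close>

text \<open>
  The index type carries no order, so Gram--Schmidt needs an arbitrary enumeration of it.
\<close>

definition idx :: "'n::finite \<Rightarrow> nat" where
  "idx = (SOME h. inj h)"

lemma inj_idx: "inj (idx :: 'n::finite \<Rightarrow> nat)"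
proof -
  obtain h :: "'n \<Rightarrow> nat" where "inj h"
    using finite_imp_inj_to_nat_seg[of "UNIV :: 'n set"] by auto
  then show ?thesis unfolding idx_def by (rule someI[of inj])
qed

text \<open>Each row minus its projection onto the span of the preceding rows, not yet normalized.
  The projection form makes equivariance under orthogonal maps and measurability direct.\<close>

definition gram_schmidt :: "real^'n::finite^'n \<Rightarrow> 'n \<Rightarrow> real^'n" where
  "gram_schmidt v i = v $ i - closest_point (span ((\<lambda>j. v $ j) ` {j. idx j < idx i})) (v $ i)"

definition orthonormalization :: "real^'n::finite^'n \<Rightarrow> real^'n^'n" where
  "orthonormalization v = (\<chi> i. gram_schmidt v i /\<^sub>R norm (gram_schmidt v i))"

text \<open>
  The invariant measure on the Grassmannian is only assumed to be invariant under \<open>SO(d)\<close>; one row,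
  arbitrarily the one with index \<^const>\<open>undefined\<close>, absorbs the sign of the determinant.
\<close>

definition frame_rotation :: "real^'n::finite^'n \<Rightarrow> real^'n^'n" where
  "frame_rotation v = (\<chi> i. (if i = undefined then det (orthonormalization v) else 1)
     *\<^sub>R orthonormalization v $ i)"

lemma row_eq_nth: "row i A = A $ i"
  by (simp add: row_def)

lemma gram_schmidt_orthogonal_span:
  "z \<in> span ((\<lambda>j. v $ j) ` {j. idx j < idx i}) \<Longrightarrow> gram_schmidt v i \<bullet> z = 0"
  unfolding gram_schmidt_def by (rule closest_point_subspace(2)[OF subspace_span])

lemma gram_schmidt_in_span:
  assumes "idx i < idx l"
  shows "gram_schmidt v i \<in> span ((\<lambda>j. v $ j) ` {j. idx j < idx l})"
proof -
  have "closest_point (span ((\<lambda>j. v $ j) ` {j. idx j < idx i})) (v $ i) \<in> span ((\<lambda>j. v $ j) ` {j. idx j < idx i})"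
    by (rule closest_point_subspace(1)[OF subspace_span])
  also have "\<dots> \<subseteq> span ((\<lambda>j. v $ j) ` {j. idx j < idx l})"
    using assms by (intro span_mono image_mono) auto
  moreover have "v $ i \<in> span ((\<lambda>j. v $ j) ` {j. idx j < idx l})"
    using assms by (intro span_base) auto
  ultimately show ?thesis
    unfolding gram_schmidt_def by (intro span_diff) auto
qed

lemma gram_schmidt_orthogonal:
  assumes "i \<noteq> j"
  shows "gram_schmidt v i \<bullet> gram_schmidt v j = 0"
proof -
  have "idx i \<noteq> idx j" using assms inj_idx by (metis injD)
  then consider "idx i < idx j" | "idx j < idx i" by linarith
  then show ?thesis
  proof cases
    case 1
    then show ?thesis using gram_schmidt_orthogonal_span[OF gram_schmidt_in_span[OF 1]] by (simp add: inner_commute)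
  next
    case 2
    then show ?thesis using gram_schmidt_orthogonal_span[OF gram_schmidt_in_span[OF 2]] by simp
  qed
qed

text \<open>Otherwise row \<open>i\<close> would lie in the span of the other rows. Adding its
  negative, itself in that span, preserves the determinant and produces a zero row.\<close>

lemma gram_schmidt_nonzero:
  assumes "det v \<noteq> 0"
  shows "gram_schmidt v i \<noteq> 0"
proof
  assume "gram_schmidt v i = 0"
  then have "v $ i = closest_point (span ((\<lambda>j. v $ j) ` {j. idx j < idx i})) (v $ i)"
    by (simp add: gram_schmidt_def)
  then have "v $ i \<in> span ((\<lambda>j. v $ j) ` {j. idx j < idx i})"
    using closest_point_subspace(1)[OF subspace_span] by metis
  also have "\<dots> \<subseteq> span {row j v |j. j \<noteq> i}"
    by (intro span_mono) (auto simp: row_eq_nth)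
  finally have "- row i v \<in> span {row j v |j. j \<noteq> i}"
    by (simp add: row_eq_nth span_neg)
  from det_row_span[of "- row i v" v i] this have "det (\<chi> k. if k = i then row i v + - row i v else row k v) = det v"
    by (simp only: span_raw_def scalar_mult_eq_scaleR)
  then show False using assms det_zero_row(2)[of i "\<chi> k. if k = i then row i v + - row i v else row k v"]
    by (simp add: row_eq_nth)
qed

lemma orthonormalization_orthogonal:
  assumes "det v \<noteq> 0"
  shows "orthogonal_matrix (orthonormalization v)"
  unfolding orthogonal_matrix_orthonormal_rows
  using gram_schmidt_nonzero[OF assms] gram_schmidt_orthogonal
  by (auto simp: row_eq_nth orthonormalization_def orthogonal_def)

text \<open>The determinant of an orthogonal matrix is 1 or -1. Multiplying one row by it keeps the
  rows orthonormal and squares the determinant.\<close>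

lemma frame_rotation:
  fixes v :: "real^'n::finite^'n"
  assumes "det v \<noteq> 0"
  shows "orthogonal_transformation ((*v) (frame_rotation v))" "det (frame_rotation v) = 1"
proof -
  let ?O = "orthonormalization v"
  have O: "orthogonal_matrix ?O" by (rule orthonormalization_orthogonal[OF assms])
  then have d: "det ?O = 1 \<or> det ?O = - 1" by (rule det_orthogonal_matrix)
  have "frame_rotation v = (\<chi> i. if i = undefined then det ?O *s (?O $ undefined) else ?O $ i)"
    by (auto simp: frame_rotation_def vec_eq_iff)
  then have "det (frame_rotation v) = det ?O * det (\<chi> i. if i = undefined then ?O $ undefined else ?O $ i)"
    by (simp add: det_row_mul)
  also have "(\<chi> i. if i = undefined then ?O $ undefined else ?O $ i) = ?O" by (simp add: vec_eq_iff)
  finally show "det (frame_rotation v) = 1" using d by auto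
  have "orthogonal_matrix (frame_rotation v)"
    using O d unfolding orthogonal_matrix_orthonormal_rows
    by (auto simp: row_eq_nth frame_rotation_def orthogonal_def)
  then show "orthogonal_transformation ((*v) (frame_rotation v))"
    by (simp add: orthogonal_transformation_matrix)
qed

section \<open>Equivariance of Gram-Schmidt under rotations\<close>

definition map_rows :: "(real^'n \<Rightarrow> real^'n) \<Rightarrow> real^'n::finite^'n \<Rightarrow> real^'n^'n" where
  "map_rows T v = (\<chi> i. T (v $ i))"

lemma map_rows_matrix:
  fixes v :: "real^'n::finite^'n"
  assumes "linear T"
  shows "map_rows T v = v ** transpose (matrix T)"
proof -
  have "T (v $ i) $ j = (\<Sum>k\<in>UNIV. v $ i $ k * (matrix T) $ j $ k)" for i j
    using arg_cong[OF fun_cong[OF matrix_vector_mul(2)[OF assms], of "v $ i"], of "\<lambda>y. y $ j"]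
    by (simp only: matrix_vector_mult_def vec_lambda_beta mult.commute)
  then show ?thesis by (simp add: map_rows_def matrix_matrix_mult_def transpose_def vec_eq_iff)
qed

lemma gram_schmidt_map_rows:
  fixes v :: "real^'n::finite^'n"
  assumes T: "orthogonal_transformation T"
  shows "gram_schmidt (map_rows T v) i = T (gram_schmidt v i)"
proof -
  have lin: "linear T" using T by (rule orthogonal_transformation_linear)
  have "span ((\<lambda>j. map_rows T v $ j) ` {j. idx j < idx i}) = T ` span ((\<lambda>j. v $ j) ` {j. idx j < idx i})"
    by (simp add: map_rows_def linear_span_image[OF lin, symmetric] image_image)
  then show ?thesis
    unfolding gram_schmidt_def
    by (simp add: map_rows_def closest_point_image[OF T subspace_span] linear_diff[OF lin])
qed

lemma orthonormalization_map_rows: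
  fixes v :: "real^'n::finite^'n"
  assumes T: "orthogonal_transformation T"
  shows "orthonormalization (map_rows T v) = map_rows T (orthonormalization v)"
proof -
  have lin: "linear T" using T by (rule orthogonal_transformation_linear)
  have "norm (T x) = norm x" for x using T by (simp add: orthogonal_transformation)
  then show ?thesis
    by (simp add: orthonormalization_def gram_schmidt_map_rows[OF T])
      (simp add: map_rows_def vec_eq_iff linear_scale[OF lin])
qed

text \<open>The components are inner products of \<open>y\<close> with the rows, and
  \<open>T\<close> moves both factors. Determinant 1 ensures that the sign correction of the
  distinguished row is the same for both matrices.\<close>

lemma frame_rotation_map_rows:
  fixes v :: "real^'n::finite^'n"
  assumes T: "orthogonal_transformation T" "det (matrix T) = 1"
  shows "frame_rotation (map_rows T v) *v T y = frame_rotation v *v y"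
proof -
  have lin: "linear T" using T(1) by (rule orthogonal_transformation_linear)
  have det: "det (map_rows T (orthonormalization v)) = det (orthonormalization v)"
    by (simp only: map_rows_matrix[OF lin] det_mul det_transpose T(2) mult_1_right)
  have rows: "frame_rotation (map_rows T v) $ i = T (frame_rotation v $ i)" for i
    unfolding frame_rotation_def orthonormalization_map_rows[OF T(1)] det
    by (simp add: map_rows_def linear_scale[OF lin])
  show ?thesis
    unfolding vec_eq_iff matrix_vector_mul_component rows
    using T(1) by (simp add: orthogonal_transformation_def)
qed

section \<open>Measurability of the random rotation\<close>

lemma borel_measurable_vec_lambda:
  fixes e :: "'n::finite \<Rightarrow> 'a \<Rightarrow> 'b::euclidean_space"
  assumes "\<And>i. e i \<in> borel_measurable M"
  shows "(\<lambda>v. \<chi> i. e i v) \<in> borel_measurable M"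
proof (subst borel_measurable_euclidean_space, intro ballI)
  fix b :: "'b^'n" assume "b \<in> Basis"
  then obtain i u where "b = axis i u" by (auto simp: Basis_vec_def)
  then show "(\<lambda>v. (\<chi> i. e i v) \<bullet> b) \<in> borel_measurable M"
    using assms by (simp add: inner_axis)
qed

lemma borel_measurable_vec_nth [measurable]:
  "(\<lambda>v. v $ i) \<in> borel_measurable (borel :: ('b::euclidean_space^'n::finite) measure)"
  by (intro borel_measurable_continuous_onI continuous_intros)

lemma borel_measurable_det [measurable]: "det \<in> borel_measurable (borel :: (real^'n::finite^'n) measure)"
  unfolding det_def[abs_def] by (intro borel_measurable_continuous_onI continuous_intros)

lemma measurable_frame_rotation [measurable]:
  "frame_rotation \<in> borel_measurable (borel :: (real^'n::finite^'n) measure)"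
proof -
  have [measurable]: "(\<lambda>v::real^'n^'n. gram_schmidt v i) \<in> borel_measurable borel" for i
    unfolding gram_schmidt_def
    by (intro borel_measurable_diff measurable_closest_point_span borel_measurable_vec_nth) auto
  have [measurable]: "orthonormalization \<in> borel_measurable (borel :: (real^'n^'n) measure)"
    unfolding orthonormalization_def[abs_def] by (intro borel_measurable_vec_lambda) measurable
  show ?thesis
    unfolding frame_rotation_def[abs_def] by (intro borel_measurable_vec_lambda) measurable
qed

lemma borel_measurable_matrix_vector_mult [measurable (raw)]:
  fixes A :: "'a \<Rightarrow> real^'n::finite^'m::finite"
  assumes "A \<in> borel_measurable M" "x \<in> borel_measurable M"
  shows "(\<lambda>z. A z *v x z) \<in> borel_measurable M"
proof -
  have "continuous_on UNIV (\<lambda>(A::real^'n^'m, x). A *v x)"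
    unfolding matrix_vector_mult_def case_prod_beta' by (intro continuous_intros)
  then have "(\<lambda>(A::real^'n^'m, x). A *v x) \<in> borel_measurable (borel \<Otimes>\<^sub>M borel)"
    unfolding borel_prod by (rule borel_measurable_continuous_onI)
  from measurable_compose[OF measurable_Pair[OF assms] this] show ?thesis by simp
qed

text \<open>
  The ball serves to make the measure of the set of frames finite; any ball that meets the invertible
  matrices would do.
\<close>

definition frames :: "(real^'n::finite^'n) set" where
  "frames = ball 0 (norm (mat 1 :: real^'n^'n) + 1) \<inter> {v. det v \<noteq> 0}"

lemma frames_borel [measurable]: "(frames :: (real^'n::finite^'n) set) \<in> sets borel"
  unfolding frames_def by measurable

text \<open>A nonempty open set inside a ball. Both bounds are needed to cancel this factor after
  averaging.\<close>

lemma emeasure_frames: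
  "emeasure lborel (frames :: (real^'n::finite^'n) set) \<noteq> 0"
  "emeasure lborel (frames :: (real^'n::finite^'n) set) \<noteq> \<infinity>"
proof -
  have "open {v::real^'n^'n. det v \<noteq> 0}"
    unfolding det_def by (intro open_Collect_neq continuous_intros)
  then have "open (frames :: (real^'n^'n) set)" by (auto simp: frames_def)
  moreover have "mat 1 \<in> (frames :: (real^'n^'n) set)" by (simp add: frames_def)
  ultimately show "emeasure lborel (frames :: (real^'n^'n) set) \<noteq> 0"
    using emeasure_lborel_open_pos[of "frames :: (real^'n^'n) set"] by (metis empty_iff less_irrefl)
  have "emeasure lborel (frames :: (real^'n^'n) set) < \<infinity>"
    by (rule order_le_less_trans[OF emeasure_mono emeasure_lborel_ball_finite]) (auto simp: frames_def)
  then show "emeasure lborel (frames :: (real^'n^'n) set) \<noteq> \<infinity>" by simp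
qed

text \<open>
  An unnormalised average of \<open>g\<close> over a random rotation. It replaces an integral with respect to
  Haar measure on \<open>SO(d)\<close>, which is not available.
\<close>

definition rotation_average :: "(real^'n::finite \<Rightarrow> ennreal) \<Rightarrow> real^'n \<Rightarrow> ennreal" where
  "rotation_average g y = (\<integral>\<^sup>+v. indicator frames v * g (frame_rotation v *v y) \<partial>lborel)"

lemma borel_measurable_rotation_average [measurable]:
  assumes [measurable]: "g \<in> borel_measurable borel"
  shows "rotation_average g \<in> borel_measurable borel"
  unfolding rotation_average_def[abs_def] by measurable

text \<open>In dimension at least 2 the rotations act transitively on spheres. If \<open>T\<close>
  takes \<open>y\<close> to \<open>y'\<close>, the substitution of \<open>map_rows T v\<close> for
  \<open>v\<close> preserves volume and \<open>frames\<close> and turns one average into the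
  other.\<close>

lemma rotation_average_radial:
  fixes y :: "real^'n::finite"
  assumes d: "2 \<le> CARD('n)" and g[measurable]: "g \<in> borel_measurable borel" and eq: "norm y = norm y'"
  shows "rotation_average g y = rotation_average g y'"
proof -
  obtain T where T: "orthogonal_transformation T" "det (matrix T) = 1" and Ty: "T y = y'"
    using rotation_exists[OF d eq] .
  have lin: "linear T" using T(1) by (rule orthogonal_transformation_linear)
  have nT: "norm (T x) = norm x" for x using T(1) by (simp add: orthogonal_transformation)
  let ?L = "map_rows T"
  have linL: "linear ?L" unfolding map_rows_def[abs_def]
    by (rule linearI) (auto simp: vec_eq_iff linear_add[OF lin] linear_scale[OF lin])
  have nL: "norm (?L v) = norm v" for v
    by (simp add: norm_vec_def[of "?L v"] norm_vec_def[of v]) (simp add: map_rows_def nT)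
  have OL: "orthogonal_transformation ?L" using linL nL by (simp add: orthogonal_transformation)
  have fr: "?L v \<in> frames \<longleftrightarrow> v \<in> frames" for v
    by (simp add: frames_def nL) (simp add: map_rows_matrix[OF lin] det_mul T(2))
  note [measurable] = borel_measurable_linear[OF linL]
  have "rotation_average g y' = (\<integral>\<^sup>+v. indicator frames (?L v) * g (frame_rotation (?L v) *v y') \<partial>lborel)"
    unfolding rotation_average_def
    by (subst lborel_distr_orthogonal[OF OL, symmetric], subst nn_integral_distr) auto
  also have "\<dots> = rotation_average g y"
    unfolding rotation_average_def Ty[symmetric] frame_rotation_map_rows[OF T]
    by (simp add: indicator_def fr)
  finally show ?thesis ..
qed

section \<open>Integration over the affine Grassmannian\<close>

text \<open>Invariance is given for images of sets, whereas \<open>distr\<close> takes preimages. It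
  is applied to the preimage of \<open>A\<close>, whose image is all of \<open>A\<close> because the
  inverse of \<open>T\<close> also preserves the Grassmannian.\<close>

lemma invariant_grassmannian_measure_distr:
  fixes M :: "(real^'n::finite) set measure"
  assumes M: "invariant_grassmannian_measure k M" and T: "orthogonal_transformation T" "det (matrix T) = 1"
  shows "distr M M ((`) T) = M"
proof (rule measure_eqI)
  have sM: "sets M = sets (grassmannian_borel k)" using M by (simp add: invariant_grassmannian_measure_def)
  then have spM: "space M = grassmannian k" using sets_eq_imp_space_eq[OF sM] by simp
  have meas: "(`) T \<in> M \<rightarrow>\<^sub>M M"
    using measurable_image_grassmannian[OF T(1), of k] by (simp add: measurable_cong_sets[OF sM sM])
  fix A assume "A \<in> sets (distr M M ((`) T))"
  then have A: "A \<in> sets M" by simp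
  let ?B = "(`) T -` A \<inter> space M"
  have B: "?B \<in> sets M" using meas A by (rule measurable_sets)
  have "(`) T ` ?B = A"
  proof
    show "A \<subseteq> (`) T ` ?B"
    proof
      fix a assume a: "a \<in> A"
      then have ag: "a \<in> grassmannian k" using sets.sets_into_space[OF A] spM by auto
      have "T ` (inv T ` a) = a"
        using orthogonal_transformation_surj[OF T(1)] by (simp add: image_f_inv_f)
      moreover have "inv T ` a \<in> grassmannian k"
        using image_grassmannian[OF orthogonal_transformation_inv[OF T(1)] ag] .
      ultimately show "a \<in> (`) T ` ?B" using a spM by (intro image_eqI[of _ _ "inv T ` a"]) auto
    qed
  qed auto
  then have "emeasure M ?B = emeasure M A"
    using M T B unfolding invariant_grassmannian_measure_def by metis
  then show "emeasure (distr M M ((`) T)) A = emeasure M A"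
    using meas A by (simp add: emeasure_distr)
qed simp

lemma grassmannian_mass_pos: "grassmannian_mass k n > 0"
  unfolding grassmannian_mass_def by (intro divide_pos_pos mult_pos_pos prod_pos) (auto simp: sphere_area_pos)

text \<open>The denominators agree, and after an index shift both numerators are the product of the
  areas from \<open>sphere_area (n - 1)\<close> down to
  \<open>sphere_area (n - k - 1)\<close>.\<close>

lemma grassmannian_mass_pred:
  assumes "1 \<le> k" "k < n"
  shows "grassmannian_mass k n * sphere_area (n - k - 1) = grassmannian_mass k (n - 1) * sphere_area (n - 1)"
proof -
  have "(\<Prod>j\<in>{1..k}. sphere_area (n - 1 - j)) = (\<Prod>j\<in>{2..Suc k}. sphere_area (n - j))"
    by (rule prod.reindex_bij_witness[of _ "\<lambda>j. j - 1" Suc]) auto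
  then have "(\<Prod>j\<in>{1..k}. sphere_area (n - 1 - j)) * sphere_area (n - 1) = (\<Prod>j\<in>{1..Suc k}. sphere_area (n - j))"
    by (subst prod.atLeast_Suc_atMost[of 1 "Suc k"]) (auto simp: numeral_2_eq_2)
  also have "\<dots> = (\<Prod>j\<in>{1..k}. sphere_area (n - j)) * sphere_area (n - k - 1)"
    using assms by simp
  finally show ?thesis by (simp add: grassmannian_mass_def)
qed

text \<open>Tonelli. The general \<open>N\<close> and \<open>w\<close> serve both the complement of
  \<alpha> with weight \<open>norm \<eta> ^ k\<close> and the whole space with weight 1.\<close>

lemma nn_integral_rotation_average:
  fixes g :: "real^'n::finite \<Rightarrow> ennreal"
  assumes "sigma_finite_measure N" and N[measurable_cong]: "sets N = sets borel"
    and [measurable]: "g \<in> borel_measurable borel" "w \<in> borel_measurable borel"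
  shows "(\<integral>\<^sup>+v. indicator frames v * (\<integral>\<^sup>+\<eta>. w \<eta> * g (frame_rotation v *v \<eta>) \<partial>N) \<partial>lborel)
    = (\<integral>\<^sup>+\<eta>. w \<eta> * rotation_average g \<eta> \<partial>N)"
proof -
  interpret N: sigma_finite_measure N by fact
  interpret pair_sigma_finite "lborel :: (real^'n^'n) measure" N ..
  have "(\<integral>\<^sup>+v. indicator frames v * (\<integral>\<^sup>+\<eta>. w \<eta> * g (frame_rotation v *v \<eta>) \<partial>N) \<partial>lborel)
      = (\<integral>\<^sup>+v. (\<integral>\<^sup>+\<eta>. w \<eta> * (indicator frames v * g (frame_rotation v *v \<eta>)) \<partial>N) \<partial>lborel)"
    by (intro nn_integral_cong, subst nn_integral_cmult[symmetric]) (auto simp: mult_ac)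
  also have "\<dots> = (\<integral>\<^sup>+\<eta>. (\<integral>\<^sup>+v. w \<eta> * (indicator frames v * g (frame_rotation v *v \<eta>)) \<partial>lborel) \<partial>N)"
    by (rule Fubini'[symmetric]) measurable
  also have "\<dots> = (\<integral>\<^sup>+\<eta>. w \<eta> * rotation_average g \<eta> \<partial>N)"
    unfolding rotation_average_def by (intro nn_integral_cong nn_integral_cmult) measurable
  finally show ?thesis .
qed

text \<open>Both sides are multiplied by the measure \<open>c\<close> of the frames, which allows
  averaging over rotations of \<open>g\<close>. Each then becomes a constant times the same
  one-dimensional integral \<open>X\<close>; \<open>grassmannian_mass_pred\<close> matches the
  constants.\<close>

lemma nn_integral_grassmannian:
  fixes M :: "(real^'n::finite) set measure" and g :: "real^'n \<Rightarrow> ennreal"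
  assumes d: "2 \<le> CARD('n)" and k: "1 \<le> k" "k < CARD('n)"
    and M: "invariant_grassmannian_measure k M" and g[measurable]: "g \<in> borel_measurable borel"
  shows "(\<integral>\<^sup>+\<alpha>. (\<integral>\<^sup>+\<eta>. ennreal (norm \<eta> ^ k) * g \<eta> \<partial>lborel_subspace (\<alpha>\<^sup>\<bottom>)) \<partial>M)
    = ennreal (grassmannian_mass k (CARD('n) - 1)) * (\<integral>\<^sup>+\<xi>. g \<xi> \<partial>lborel)"
proof -
  let ?d = "CARD('n)"
  let ?m = "?d - k"
  define c where "c = emeasure lborel (frames :: (real^'n^'n) set)"
  \<comment> \<open>The radial profile of the averaged \<open>g\<close> along an arbitrary unit
    vector; negative \<open>r\<close> is cut off by the indicator in \<open>X\<close>.\<close>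
  define \<Gamma> where "\<Gamma> r = rotation_average g (r *\<^sub>R axis undefined 1)" for r
  define X where "X = (\<integral>\<^sup>+r. ennreal (r ^ (?d - 1)) * indicator {0..} r * \<Gamma> r \<partial>lborel)"
  define J where "J h = (\<integral>\<^sup>+\<alpha>. (\<integral>\<^sup>+\<eta>. ennreal (norm \<eta> ^ k) * h \<eta> \<partial>lborel_subspace (\<alpha>\<^sup>\<bottom>)) \<partial>M)"
    for h :: "real^'n \<Rightarrow> ennreal"
  have [measurable]: "\<Gamma> \<in> borel_measurable borel" unfolding \<Gamma>_def by measurable
  have rot\<Gamma>: "rotation_average g \<eta> = \<Gamma> (norm \<eta>)" for \<eta>
    unfolding \<Gamma>_def by (rule rotation_average_radial[OF d g]) simp
  have sM[measurable_cong]: "sets M = sets (grassmannian_borel k)"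
    using M by (simp add: invariant_grassmannian_measure_def)
  then have spM: "space M = grassmannian k" using sets_eq_imp_space_eq[OF sM] by simp
  have massM: "emeasure M (space M) = ennreal (grassmannian_mass k ?d)"
    using M by (simp add: invariant_grassmannian_measure_def)
  interpret M: finite_measure M by standard (simp add: massM)
  interpret pair_sigma_finite "lborel :: (real^'n^'n) measure" M ..
  have sub: "subspace \<alpha>" "dim (\<alpha>\<^sup>\<bottom>) = ?m" if "\<alpha> \<in> space M" for \<alpha>
    using that dim_orthogonal_comp[of \<alpha>] by (auto simp: spM grassmannian_def)
  have meas: "(\<lambda>\<alpha>. \<integral>\<^sup>+\<eta>. h \<eta> \<partial>lborel_subspace (\<alpha>\<^sup>\<bottom>)) \<in> borel_measurable M"
    if [measurable]: "h \<in> borel_measurable borel" for h :: "real^'n \<Rightarrow> ennreal"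
    by (rule measurable_nn_integral_orthogonal_comp[where k = k]) measurable
  \<comment> \<open>Rotating \<open>g\<close> amounts to rotating \<alpha>, since the weight depends
    on the norm only, and \<open>M\<close> is invariant under this.\<close>
  have inv: "J (\<lambda>\<eta>. g (T \<eta>)) = J g" if T: "orthogonal_transformation T" "det (matrix T) = 1" for T
  proof -
    have nT: "norm (T x) = norm x" for x using T(1) by (simp add: orthogonal_transformation)
    have meas_im: "(`) T \<in> M \<rightarrow>\<^sub>M M"
      using measurable_image_grassmannian[OF T(1), of k] by (simp add: measurable_cong_sets[OF sM sM])
    have "J (\<lambda>\<eta>. g (T \<eta>)) = (\<integral>\<^sup>+\<alpha>. (\<integral>\<^sup>+\<eta>. ennreal (norm \<eta> ^ k) * g \<eta> \<partial>lborel_subspace ((T ` \<alpha>)\<^sup>\<bottom>)) \<partial>M)"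
      unfolding J_def
      by (intro nn_integral_cong, subst nn_integral_orthogonal_comp_image[OF sub(1) T(1), symmetric]) (auto simp: nT)
    also have "\<dots> = (\<integral>\<^sup>+\<alpha>. (\<integral>\<^sup>+\<eta>. ennreal (norm \<eta> ^ k) * g \<eta> \<partial>lborel_subspace (\<alpha>\<^sup>\<bottom>)) \<partial>distr M M ((`) T))"
      by (rule nn_integral_distr[OF meas_im, symmetric], unfold measurable_distr_eq1, rule meas) measurable
    finally show ?thesis by (simp add: invariant_grassmannian_measure_distr[OF M T] J_def)
  qed
  have "c * J g = (\<integral>\<^sup>+v. indicator frames (v :: real^'n^'n) * J g \<partial>lborel)"
    by (simp add: nn_integral_multc c_def)
  also have "\<dots> = (\<integral>\<^sup>+v. indicator frames v * J (\<lambda>\<eta>. g (frame_rotation v *v \<eta>)) \<partial>lborel)"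
  proof (rule nn_integral_cong)
    fix v :: "real^'n^'n"
    show "indicator frames v * J g = indicator frames v * J (\<lambda>\<eta>. g (frame_rotation v *v \<eta>))"
    proof (cases "v \<in> frames")
      case True
      then have "det v \<noteq> 0" by (simp add: frames_def)
      then show ?thesis using inv[of "(*v) (frame_rotation v)"] frame_rotation[of v] by simp
    qed simp
  qed
  also have "\<dots> = (\<integral>\<^sup>+v. (\<integral>\<^sup>+\<alpha>. indicator frames v * (\<integral>\<^sup>+\<eta>. ennreal (norm \<eta> ^ k) * g (frame_rotation v *v \<eta>)
      \<partial>lborel_subspace (\<alpha>\<^sup>\<bottom>)) \<partial>M) \<partial>lborel)"
    unfolding J_def by (intro nn_integral_cong nn_integral_cmult[symmetric] meas) measurable
  also have "\<dots> = (\<integral>\<^sup>+\<alpha>. (\<integral>\<^sup>+v. indicator frames v * (\<integral>\<^sup>+\<eta>. ennreal (norm \<eta> ^ k) * g (frame_rotation v *v \<eta>)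
      \<partial>lborel_subspace (\<alpha>\<^sup>\<bottom>)) \<partial>lborel) \<partial>M)"
  proof (rule Fubini'[symmetric])
    have "(\<lambda>z. \<integral>\<^sup>+\<eta>. ennreal (norm \<eta> ^ k) * g (frame_rotation (fst z) *v \<eta>) \<partial>lborel_subspace ((snd z)\<^sup>\<bottom>))
        \<in> borel_measurable ((lborel :: (real^'n^'n) measure) \<Otimes>\<^sub>M M)"
      by (rule measurable_nn_integral_orthogonal_comp[where k = k]) measurable
    then show "(\<lambda>(v, \<alpha>). indicator frames v * (\<integral>\<^sup>+\<eta>. ennreal (norm \<eta> ^ k) * g (frame_rotation v *v \<eta>)
        \<partial>lborel_subspace (\<alpha>\<^sup>\<bottom>))) \<in> borel_measurable ((lborel :: (real^'n^'n) measure) \<Otimes>\<^sub>M M)"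
      unfolding case_prod_beta' by measurable
  qed
  also have "\<dots> = (\<integral>\<^sup>+\<alpha>. ennreal (sphere_area (?m - 1)) * X \<partial>M)"
  proof (rule nn_integral_cong)
    fix \<alpha> assume \<alpha>: "\<alpha> \<in> space M"
    have "(\<integral>\<^sup>+v. indicator frames v * (\<integral>\<^sup>+\<eta>. ennreal (norm \<eta> ^ k) * g (frame_rotation v *v \<eta>)
        \<partial>lborel_subspace (\<alpha>\<^sup>\<bottom>)) \<partial>lborel)
        = (\<integral>\<^sup>+\<eta>. ennreal (norm \<eta> ^ k) * rotation_average g \<eta> \<partial>lborel_subspace (\<alpha>\<^sup>\<bottom>))"
      by (intro nn_integral_rotation_average sigma_finite_lborel_subspace subspace_orthogonal_comp) auto
    also have "\<dots> = ennreal (sphere_area (?m - 1)) *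
        (\<integral>\<^sup>+r. ennreal (r ^ (?m - 1)) * indicator {0..} r * (ennreal (r ^ k) * \<Gamma> r) \<partial>lborel)"
      unfolding rot\<Gamma> using k
      by (intro nn_integral_lborel_subspace_norm subspace_orthogonal_comp sub \<alpha>) auto
    also have "(\<integral>\<^sup>+r. ennreal (r ^ (?m - 1)) * indicator {0..} r * (ennreal (r ^ k) * \<Gamma> r) \<partial>lborel) = X"
      unfolding X_def
    proof (rule nn_integral_cong)
      fix r :: real
      \<comment> \<open>The weight makes up for the codimension:
        \<open>(d - k - 1) + k = d - 1\<close>, the exponent of polar coordinates on the whole
        space.\<close>
      have "ennreal (r ^ (?m - 1)) * ennreal (r ^ k) = ennreal (r ^ (?d - 1))" if "r \<ge> 0"
        using that k by (simp add: ennreal_mult[symmetric] power_add[symmetric])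
      then show "ennreal (r ^ (?m - 1)) * indicator {0..} r * (ennreal (r ^ k) * \<Gamma> r)
          = ennreal (r ^ (?d - 1)) * indicator {0..} r * \<Gamma> r"
        by (cases "r \<ge> 0") (simp_all add: mult.assoc[symmetric])
    qed
    finally show "(\<integral>\<^sup>+v. indicator frames v * (\<integral>\<^sup>+\<eta>. ennreal (norm \<eta> ^ k) * g (frame_rotation v *v \<eta>)
        \<partial>lborel_subspace (\<alpha>\<^sup>\<bottom>)) \<partial>lborel) = ennreal (sphere_area (?m - 1)) * X" .
  qed
  also have "\<dots> = ennreal (grassmannian_mass k ?d * sphere_area (?m - 1)) * X"
    by (simp add: massM ennreal_mult less_imp_le[OF sphere_area_pos] less_imp_le[OF grassmannian_mass_pos] mult_ac)
  also have "grassmannian_mass k ?d * sphere_area (?m - 1) = grassmannian_mass k (?d - 1) * sphere_area (?d - 1)"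
    using grassmannian_mass_pred[OF k] .
  also have "ennreal \<dots> * X = ennreal (grassmannian_mass k (?d - 1)) * (ennreal (sphere_area (?d - 1)) * X)"
    by (simp add: ennreal_mult less_imp_le[OF sphere_area_pos] less_imp_le[OF grassmannian_mass_pos] mult_ac)
  also have "ennreal (sphere_area (?d - 1)) * X = (\<integral>\<^sup>+x. \<Gamma> (norm (x :: real^'n)) \<partial>lborel)"
    unfolding X_def lborel_subspace_UNIV[symmetric]
    by (rule nn_integral_lborel_subspace_norm[symmetric]) auto
  also have "\<dots> = (\<integral>\<^sup>+x. 1 * rotation_average g x \<partial>lborel)" by (simp add: rot\<Gamma>)
  also have "\<dots> = (\<integral>\<^sup>+v. indicator frames v * (\<integral>\<^sup>+x. 1 * g (frame_rotation v *v x) \<partial>lborel) \<partial>lborel)"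
    by (rule nn_integral_rotation_average[symmetric]) (auto intro: lborel.sigma_finite_measure_axioms)
  \<comment> \<open>The averaging is undone: every rotation preserves \<open>lborel\<close>, so only
    the measure of the frames remains.\<close>
  also have "\<dots> = (\<integral>\<^sup>+v. indicator frames (v :: real^'n^'n) * (\<integral>\<^sup>+x. g x \<partial>lborel) \<partial>lborel)"
  proof (rule nn_integral_cong)
    fix v :: "real^'n^'n"
    show "indicator frames v * (\<integral>\<^sup>+x. 1 * g (frame_rotation v *v x) \<partial>lborel)
        = indicator frames v * (\<integral>\<^sup>+x. g x \<partial>lborel)"
    proof (cases "v \<in> frames")
      case True
      then have "orthogonal_transformation ((*v) (frame_rotation v))"
        by (simp add: frames_def frame_rotation)
      from lborel_distr_orthogonal[OF this]
      have "(\<integral>\<^sup>+x. g x \<partial>lborel) = (\<integral>\<^sup>+x. g x \<partial>distr lborel borel ((*v) (frame_rotation v)))" by simp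
      then show ?thesis by (subst (asm) nn_integral_distr) auto
    qed simp
  qed
  also have "\<dots> = c * (\<integral>\<^sup>+x. g x \<partial>lborel)" by (simp add: nn_integral_multc c_def)
  finally have "c * J g = c * (ennreal (grassmannian_mass k (?d - 1)) * (\<integral>\<^sup>+x. g x \<partial>lborel))"
    by (simp add: mult_ac)
  moreover have "c \<noteq> 0" "c \<noteq> \<infinity>" unfolding c_def by (rule emeasure_frames)+
  ultimately show ?thesis by (simp add: ennreal_mult_cancel_left J_def)
qed

section \<open>From the integral identity to the Sobolev norms\<close>

lemma borel_measurable_fourier:
  fixes f :: "real^'n::finite \<Rightarrow> complex"
  assumes [measurable]: "f \<in> borel_measurable borel"
  shows "fourier f \<in> borel_measurable borel"
  unfolding fourier_def[abs_def] by measurable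

text \<open>The shift leaves the difference of the two orders unchanged, so only the power of the
  norm gains \<open>k / p\<close>, which becomes \<open>k\<close> after taking \<open>p\<close>-th
  powers.\<close>

lemma sobolev_weight_shift:
  assumes p: "1 \<le> p" and k: "1 \<le> k" and a: "a \<ge> 0"
  shows "(sobolev_weight (s + real k / p) (t + real k / p) \<eta> * ((2 * pi) powr (real k / 2) * a)) powr p
    = (2 * pi) powr (p * real k / 2) * (norm \<eta> ^ k * (sobolev_weight s t \<eta> * a) powr p)"
\<comment> \<open>At the origin both sides vanish by the convention
  \<open>0 powr x = 0\<close>.\<close>
proof (cases "\<eta> = 0")
  case True
  then show ?thesis using p k by (simp add: sobolev_weight_def)
next
  case False
  have "(sobolev_weight (s + real k / p) (t + real k / p) \<eta> * ((2 * pi) powr (real k / 2) * a))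
      = norm \<eta> powr (real k / p) * (2 * pi) powr (real k / 2) * (sobolev_weight s t \<eta> * a)"
    by (simp add: sobolev_weight_def powr_add mult_ac)
  also have "\<dots> powr p = (norm \<eta> powr (real k / p)) powr p * ((2 * pi) powr (real k / 2)) powr p * (sobolev_weight s t \<eta> * a) powr p"
    using a by (simp add: powr_mult sobolev_weight_def)
  also have "(norm \<eta> powr (real k / p)) powr p = norm \<eta> ^ k"
    using False p by (simp add: powr_powr powr_realpow)
  also have "((2 * pi) powr (real k / 2)) powr p = (2 * pi) powr (p * real k / 2)"
    by (simp add: powr_powr mult.commute)
  finally show ?thesis by (simp add: mult_ac)
qed

theorem theorem4p2:
  fixes f :: "real^'n::finite \<Rightarrow> complex"
    and k :: nat
    and p s t :: real
    and M :: "(real^'n) set measure"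
  assumes "2 \<le> CARD('n)"
    and "1 \<le> k" and "k \<le> CARD('n) - 1"
    and "1 \<le> p"
    and "t > - real CARD('n) / p"
    and "invariant_grassmannian_measure k M"
    and "schwartz f"
  shows "affine_sobolev_norm M k (s + real k / p) (t + real k / p) p (k_plane_transform f)
           = sobolev_norm s t p f"
proof -
  let ?d = "CARD('n)"
  have k: "1 \<le> k" "k < ?d" using assms by auto
  have [measurable]: "f \<in> borel_measurable borel"
    using schwartz_integrable[OF assms(7)] by simp
  note [measurable] = borel_measurable_fourier
  define g where "g \<eta> = ennreal ((sobolev_weight s t \<eta> * cmod (fourier f \<eta>)) powr p)" for \<eta>
  have [measurable]: "g \<in> borel_measurable borel"
    unfolding g_def sobolev_weight_def by measurable
  let ?c = "(2 * pi) powr (p * real k / 2)" and ?m = "grassmannian_mass k (?d - 1)"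
  have sM[measurable_cong]: "sets M = sets (grassmannian_borel k)"
    using assms(6) by (simp add: invariant_grassmannian_measure_def)
  then have spM: "space M = grassmannian k" using sets_eq_imp_space_eq[OF sM] by simp
  have "(\<integral>\<^sup>+\<alpha>. (\<integral>\<^sup>+\<eta>. ennreal ((sobolev_weight (s + real k / p) (t + real k / p) \<eta>
          * cmod (fiber_fourier k (k_plane_transform f) \<alpha> \<eta>)) powr p) \<partial>lborel_subspace (\<alpha>\<^sup>\<bottom>)) \<partial>M)
      = (\<integral>\<^sup>+\<alpha>. ennreal ?c * (\<integral>\<^sup>+\<eta>. ennreal (norm \<eta> ^ k) * g \<eta> \<partial>lborel_subspace (\<alpha>\<^sup>\<bottom>)) \<partial>M)"
  proof (rule nn_integral_cong)
    fix \<alpha> assume "\<alpha> \<in> space M"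
    then have \<alpha>: "subspace \<alpha>" by (simp add: spM grassmannian_def)
    have "(\<integral>\<^sup>+\<eta>. ennreal ((sobolev_weight (s + real k / p) (t + real k / p) \<eta>
          * cmod (fiber_fourier k (k_plane_transform f) \<alpha> \<eta>)) powr p) \<partial>lborel_subspace (\<alpha>\<^sup>\<bottom>))
        = (\<integral>\<^sup>+\<eta>. ennreal ?c * (ennreal (norm \<eta> ^ k) * g \<eta>) \<partial>lborel_subspace (\<alpha>\<^sup>\<bottom>))"
    \<comment> \<open>The slice identity requires \<eta> in the complement of \<alpha>, which holds
      almost everywhere for this measure.\<close>
    proof (rule nn_integral_cong_AE)
      show "AE \<eta> in lborel_subspace (\<alpha>\<^sup>\<bottom>). ennreal ((sobolev_weight (s + real k / p) (t + real k / p) \<eta>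
          * cmod (fiber_fourier k (k_plane_transform f) \<alpha> \<eta>)) powr p) = ennreal ?c * (ennreal (norm \<eta> ^ k) * g \<eta>)"
        using AE_lborel_subspace[OF subspace_orthogonal_comp]
      proof eventually_elim
        case (elim \<eta>)
        have "cmod (fiber_fourier k (k_plane_transform f) \<alpha> \<eta>) = (2 * pi) powr (real k / 2) * cmod (fourier f \<eta>)"
          by (simp add: fiber_fourier_k_plane_transform[OF assms(7) \<alpha> elim] norm_mult)
        then show ?case
          by (simp add: sobolev_weight_shift[OF assms(4,2) norm_ge_zero] g_def ennreal_mult)
      qed
    qed
    also have "\<dots> = ennreal ?c * (\<integral>\<^sup>+\<eta>. ennreal (norm \<eta> ^ k) * g \<eta> \<partial>lborel_subspace (\<alpha>\<^sup>\<bottom>))"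
      by (rule nn_integral_cmult) measurable
    finally show "(\<integral>\<^sup>+\<eta>. ennreal ((sobolev_weight (s + real k / p) (t + real k / p) \<eta>
          * cmod (fiber_fourier k (k_plane_transform f) \<alpha> \<eta>)) powr p) \<partial>lborel_subspace (\<alpha>\<^sup>\<bottom>))
        = ennreal ?c * (\<integral>\<^sup>+\<eta>. ennreal (norm \<eta> ^ k) * g \<eta> \<partial>lborel_subspace (\<alpha>\<^sup>\<bottom>))" .
  qed
  also have "\<dots> = ennreal ?c * (\<integral>\<^sup>+\<alpha>. (\<integral>\<^sup>+\<eta>. ennreal (norm \<eta> ^ k) * g \<eta> \<partial>lborel_subspace (\<alpha>\<^sup>\<bottom>)) \<partial>M)"
    by (rule nn_integral_cmult, rule measurable_nn_integral_orthogonal_comp[where k = k]) measurable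
  also have "\<dots> = ennreal ?c * (ennreal ?m * (\<integral>\<^sup>+\<xi>. g \<xi> \<partial>lborel))"
    by (subst nn_integral_grassmannian[OF assms(1) k assms(6)]) auto
  finally have "affine_sobolev_norm M k (s + real k / p) (t + real k / p) p (k_plane_transform f)
    = ennreal_root p (ennreal ((2 * pi) powr (- p * real k / 2) / ?m) * (ennreal ?c * (ennreal ?m * (\<integral>\<^sup>+\<xi>. g \<xi> \<partial>lborel))))"
    by (simp add: affine_sobolev_norm_def)
  \<comment> \<open>The normalization of the norm cancels the power of \<open>2 * pi\<close> from
    the slice identity and the mass from the integral identity. The real factors are merged first,
    by their nonnegativity.\<close>
  also have "ennreal ((2 * pi) powr (- p * real k / 2) / ?m) * (ennreal ?c * (ennreal ?m * (\<integral>\<^sup>+\<xi>. g \<xi> \<partial>lborel)))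
    = ennreal ((2 * pi) powr (- p * real k / 2) / ?m * (?c * ?m)) * (\<integral>\<^sup>+\<xi>. g \<xi> \<partial>lborel)"
    by (simp only: ennreal_mult mult.assoc powr_ge_zero less_imp_le[OF grassmannian_mass_pos]
        divide_nonneg_nonneg mult_nonneg_nonneg)
  also have "(2 * pi) powr (- p * real k / 2) / ?m * (?c * ?m) = (2 * pi) powr (- p * real k / 2 + p * real k / 2)"
    using grassmannian_mass_pos[of k "?d - 1"] by (simp add: powr_add[symmetric])
  also have "\<dots> = 1" by simp
  finally show ?thesis by (simp add: sobolev_norm_def g_def)
qed

end
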